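(* Let $(G_n)_{n\ge1}$, $G_n=(V(G_n),E(G_n))$ with $|V(G_n)|=n$, be a locally tree-like sequence of finite (possibly random) graphs. Let $q\ge 2$, $w\ge 0$ and $B\ge 0$. Then $$\lim_{n\to\infty}\frac1n\log Z_{G_n}(q,w,B)=\lim_{n\to\infty}\frac1n\log Z^{(2)}_{G_n}(q,w,B),$$ where limits are in probability, and the equality means that if one of the two limits exists then so does the other and they are equal.
   Context: For a finite graph $G$ and $\omega\in\{0,1\}^{E(G)}$, $\mathscr C(\omega)$ is the collection of connected components of $(V(G),\{e:\omega_e=1\})$ (isolated vertices are components), $|C|$ is the number of vertices of $C$, and $$Z_G(q,w,B)=\sum_{\omega\in\{0,1\}^{E(G)}}\prod_{e\in E(G)}w^{\omega_e}\prod_{C\in\mathscr C(\omega)}\big(1+(q-1)e^{-B|C|}\big).$$ With $E(S)$ the set of edges having both endpoints in $S\subseteq V(G)$, $$Z^{(2)}_G(q,w,B)=\sum_{S\subseteq V(G)}(1+w)^{|E(S)|}\Big(1+\frac{w}{q-1}\Big)^{|E(V(G)\setminus S)|}\big((q-1)e^{-B}\big)^{|V(G)|-|S|}.$$ The sequence $(G_n)$ is called locally tree-like when both of the following hold. (i) Uniform sparsity: the degree $D_n$ of a uniformly random vertex of $G_n$ satisfies $D_n\to D$ in distribution and $\mathbb E[D_n]\to\mathbb E[D]<\infty$ for some random variable $D$. (ii) $G_n$ converges locally in probability to a random rooted graph $(G,o)$ that is almost surely a tree, i.e., for every $r\ge 0$ and every finite rooted graph $H$, the proportion of vertices $v\in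 V(G_n)$ whose rooted $r$-neighbourhood in $G_n$ is isomorphic to $H$ converges in probability to the probability that the $r$-neighbourhood of $o$ in $G$ is isomorphic to $H$. *)

theory Defs
  imports "HOL-Probability.Probability"
begin

section \<open>Graphs\<close>

text \<open>
  Graphs are simple and undirected: an edge is a two-element set of vertices.
\<close>

datatype 'v graph = Graph (verts: "'v set") (edges: "'v set set")

definition simple_graph :: "'v graph \<Rightarrow> bool" where
  "simple_graph G \<longleftrightarrow> (\<forall>e\<in>edges G. e \<subseteq> verts G \<and> card e = 2)"

definition finite_graph :: "'v graph \<Rightarrow> bool" where
  "finite_graph G \<longleftrightarrow> simple_graph G \<and> finite (verts G)"

definition degree :: "'v graph \<Rightarrow> 'v \<Rightarrow> nat" where
  "degree G v = card {e \<in> edges G. v \<in> e}"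

definition locally_finite :: "'v graph \<Rightarrow> bool" where
  "locally_finite G \<longleftrightarrow> (\<forall>v\<in>verts G. finite {e \<in> edges G. v \<in> e})"

definition adj :: "'v graph \<Rightarrow> ('v \<times> 'v) set" where
  "adj G = {(u, v). {u, v} \<in> edges G}"

definition connected_in :: "'v graph \<Rightarrow> ('v \<times> 'v) set" where
  "connected_in G = {(u, v). u \<in> verts G \<and> v \<in> verts G \<and> (u, v) \<in> (adj G)\<^sup>*}"

definition components :: "'v graph \<Rightarrow> 'v set set" where
  "components G = verts G // connected_in G"

definition connected_graph :: "'v graph \<Rightarrow> bool" where
  "connected_graph G \<longleftrightarrow> verts G \<noteq> {} \<and> (\<forall>u\<in>verts G. \<forall>v\<in>verts G. (u, v) \<in> (adj G)\<^sup>*)"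

definition cycle :: "'v graph \<Rightarrow> 'v list \<Rightarrow> bool" where
  "cycle G c \<longleftrightarrow> 3 \<le> length c \<and> distinct c \<and>
     (\<forall>i<length c. {c ! i, c ! (Suc i mod length c)} \<in> edges G)"

definition tree :: "'v graph \<Rightarrow> bool" where
  "tree G \<longleftrightarrow> connected_graph G \<and> (\<nexists>c. cycle G c)"

text \<open>Edges with both endpoints in \<open>S\<close>.\<close>

definition edges_within :: "'v graph \<Rightarrow> 'v set \<Rightarrow> 'v set set" where
  "edges_within G S = {e \<in> edges G. e \<subseteq> S}"


section \<open>The two partition functions\<close>

definition open_subgraph :: "'v graph \<Rightarrow> ('v set \<Rightarrow> nat) \<Rightarrow> 'v graph" where
  "open_subgraph G \<omega> = Graph (verts G) {e \<in> edges G. \<omega> e = 1}"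

text \<open>
  \<open>edges G \<rightarrow>\<^sub>E {0, 1}\<close> consists of the functions that are \<open>undefined\<close> outside \<open>edges G\<close>,
  so each configuration on the edges is counted once.
\<close>

definition Z :: "'v graph \<Rightarrow> real \<Rightarrow> real \<Rightarrow> real \<Rightarrow> real" where
  "Z G q w B =
     (\<Sum>\<omega> \<in> edges G \<rightarrow>\<^sub>E {0, 1}.
        (\<Prod>e\<in>edges G. w ^ \<omega> e) *
        (\<Prod>C\<in>components (open_subgraph G \<omega>). 1 + (q - 1) * exp (- B * real (card C))))"

definition Z2 :: "'v graph \<Rightarrow> real \<Rightarrow> real \<Rightarrow> real \<Rightarrow> real" where
  "Z2 G q w B =
     (\<Sum>S\<in>Pow (verts G).
        (1 + w) ^ card (edges_within G S) *
        (1 + w / (q - 1)) ^ card (edges_within G (verts G - S)) *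
        ((q - 1) * exp (- B)) ^ (card (verts G) - card S))"


section \<open>Rooted graphs and neighbourhoods\<close>

type_synonym 'v rooted_graph = "'v graph \<times> 'v"

text \<open>
  The \<open>r\<close>-neighbourhood of \<open>v\<close> is the subgraph induced on the vertices at graph distance at most \<open>r\<close>
  from \<open>v\<close>, rooted at \<open>v\<close>.
\<close>

definition nbhd :: "'v graph \<Rightarrow> nat \<Rightarrow> 'v \<Rightarrow> 'v rooted_graph" where
  "nbhd G r v =
     (let U = {u \<in> verts G. \<exists>k\<le>r. (v, u) \<in> adj G ^^ k} in (Graph U (edges_within G U), v))"

definition rooted_iso :: "'v rooted_graph \<Rightarrow> 'u rooted_graph \<Rightarrow> bool" where
  "rooted_iso A H \<longleftrightarrow>
     (\<exists>f. bij_betw f (verts (fst A)) (verts (fst H)) \<and> f (snd A) = snd H \<and>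
          (\<lambda>e. f ` e) ` edges (fst A) = edges (fst H))"

definition finite_rooted_graph :: "'v rooted_graph \<Rightarrow> bool" where
  "finite_rooted_graph H \<longleftrightarrow> finite_graph (fst H) \<and> snd H \<in> verts (fst H)"


section \<open>Locally tree-like sequences of random graphs\<close>

text \<open>
  A random graph on \<open>n\<close> vertices. For a countable type of vertices there are only countably many
  finite graphs, and measurability into the discrete space of graphs amounts to measurability of all
  events that the random graph equals a given finite graph. Deterministic graphs are the constant
  functions.
\<close>

definition random_finite_graph :: "'w measure \<Rightarrow> nat \<Rightarrow> ('w \<Rightarrow> 'v graph) \<Rightarrow> bool" where
  "random_finite_graph M n G \<longleftrightarrow> G \<in> M \<rightarrow>\<^sub>M count_space UNIV \<and>
     (\<forall>x\<in>space M. finite_graph (G x) \<and> card (verts (G x)) = n)"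

definition tendsto_in_prob :: "'w measure \<Rightarrow> (nat \<Rightarrow> 'w \<Rightarrow> real) \<Rightarrow> ('w \<Rightarrow> real) \<Rightarrow> bool" where
  "tendsto_in_prob M X Y \<longleftrightarrow> Y \<in> borel_measurable M \<and>
     (\<forall>\<epsilon>>0. (\<lambda>n. measure M {x \<in> space M. \<bar>X n x - Y x\<bar> > \<epsilon>}) \<longlonglongrightarrow> 0)"

text \<open>
  The law of the degree of a uniformly random vertex of a random graph: first the graph is sampled,
  then, given the graph, the vertex. The randomness of the graph is thus averaged over.
\<close>

definition degree_law :: "'w measure \<Rightarrow> ('w \<Rightarrow> 'v graph) \<Rightarrow> real measure" where
  "degree_law M G =
     M \<bind> (\<lambda>x. distr (uniform_count_measure (verts (G x))) borel (\<lambda>v. real (degree (G x) v)))"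

text \<open>The limiting random variable \<open>D\<close> enters only through its law \<open>\<mu>\<close>.\<close>

definition uniformly_sparse :: "'w measure \<Rightarrow> (nat \<Rightarrow> 'w \<Rightarrow> 'v graph) \<Rightarrow> bool" where
  "uniformly_sparse M G \<longleftrightarrow>
     (\<exists>\<mu>. real_distribution \<mu> \<and> weak_conv_m (\<lambda>n. degree_law M (G n)) \<mu> \<and>
          integrable \<mu> (\<lambda>d. d) \<and>
          (\<lambda>n. \<integral>d. d \<partial>degree_law M (G n)) \<longlonglongrightarrow> (\<integral>d. d \<partial>\<mu>))"

text \<open>
  As usual for local limits, rooted graphs are locally finite, and the sigma-algebra on them is
  generated by the isomorphism types of the neighbourhoods of the root. Finite rooted graphs on
  natural numbers represent all isomorphism types of finite rooted graphs.
\<close>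

definition random_rooted_graph :: "'l measure \<Rightarrow> ('l \<Rightarrow> 'u rooted_graph) \<Rightarrow> bool" where
  "random_rooted_graph N T \<longleftrightarrow>
     (\<forall>y\<in>space N. simple_graph (fst (T y)) \<and> locally_finite (fst (T y)) \<and>
                   snd (T y) \<in> verts (fst (T y))) \<and>
     (\<forall>r. \<forall>H::nat rooted_graph. finite_rooted_graph H \<longrightarrow>
        {y \<in> space N. rooted_iso (nbhd (fst (T y)) r (snd (T y))) H} \<in> sets N)"

definition converges_locally_in_prob ::
  "'w measure \<Rightarrow> (nat \<Rightarrow> 'w \<Rightarrow> 'v graph) \<Rightarrow> 'l measure \<Rightarrow> ('l \<Rightarrow> 'u rooted_graph) \<Rightarrow> bool" where
  "converges_locally_in_prob M G N T \<longleftrightarrow>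
     (\<forall>r. \<forall>H::nat rooted_graph. finite_rooted_graph H \<longrightarrow>
        tendsto_in_prob M
          (\<lambda>n x. real (card {v \<in> verts (G n x). rooted_iso (nbhd (G n x) r v) H}) /
                 real (card (verts (G n x))))
          (\<lambda>_. measure N {y \<in> space N. rooted_iso (nbhd (fst (T y)) r (snd (T y))) H}))"

text \<open>The sequence \<open>G\<close> is locally tree-like, with local limit \<open>T\<close> defined on the space \<open>N\<close>.\<close>

definition locally_tree_like ::
  "'w measure \<Rightarrow> (nat \<Rightarrow> 'w \<Rightarrow> 'v graph) \<Rightarrow> 'l measure \<Rightarrow> ('l \<Rightarrow> 'u rooted_graph) \<Rightarrow> bool" where
  "locally_tree_like M G N T \<longleftrightarrow>
     uniformly_sparse M G \<and>
     prob_space N \<and> random_rooted_graph N T \<and>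
     converges_locally_in_prob M G N T \<and>
     (AE y in N. tree (fst (T y)))"

end

theory Submission
  imports Defs
begin

text \<open>
  Put \<open>p = q - 1\<close> and, for a set \<open>A\<close> of edges and a component \<open>C\<close> of \<open>(V, A)\<close>, let \<open>A(C)\<close> be the set
  of edges of \<open>A\<close> inside \<open>C\<close>. Both partition functions are sums over the same edge sets:
  \<open>Z = \<Sum>\<^sub>A w^|A| \<Prod>\<^sub>C (1 + p e^(-B|C|))\<close> by definition (lemma \<open>Z_expansion\<close>), and
  \<open>Z2 = \<Sum>\<^sub>A w^|A| \<Prod>\<^sub>C (1 + p^(|C| - |A(C)|) e^(-B|C|))\<close> (lemma \<open>Z2_expansion\<close>). The latter is obtained by
  expanding the powers of \<open>1 + w\<close> and \<open>1 + w / p\<close> over edge sets: \<open>A\<close> occurs together with a vertex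
  set \<open>S\<close> exactly if \<open>S\<close> is a union of components of \<open>(V, A)\<close>, so that the sum over \<open>S\<close> is a product
  over components.

  A component satisfies \<open>|C| \<le> |A(C)| + 1\<close>, with equality if it is a tree. As \<open>p \<ge> 1\<close>, the factors of
  \<open>Z2\<close> are at most those of \<open>Z\<close>; they agree on trees, and on all other components they differ by a ratio
  of at most \<open>q\<close>, since the factors of \<open>Z\<close> are at most \<open>q\<close> and those of \<open>Z2\<close> at least \<open>1\<close>. Hence \<open>Z2 \<le> Z \<le> q^k Z2\<close>, where \<open>k\<close> bounds
  the number of components that are not trees. At most \<open>n / R\<close> components have more than \<open>R\<close> vertices,
  and a component with at most \<open>R\<close> vertices that is not a tree consists of vertices with a cycle in
  their neighbourhood of radius \<open>R\<^sup>2\<close>. So \<open>k\<close> can be taken as \<open>n / R\<close> plus the number of such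
  vertices (lemma \<open>ln_Z_diff\<close>).

  Local convergence to a tree implies that, for fixed \<open>R\<close>, the fraction of vertices with a cycle nearby
  tends to \<open>0\<close> in probability (lemma \<open>cyclic_verts_rare\<close>): finitely many acyclic neighbourhood types
  carry almost all of the mass of the limit, hence almost all of the vertices. As \<open>R\<close> is arbitrary, the
  difference of the two normalised logarithms tends to \<open>0\<close> in probability.
\<close>

section \<open>Subgraphs, cycles and spanning trees\<close>

text \<open>The subgraph of \<open>G\<close> induced on \<open>U\<close>, where \<open>U\<close> is meant to be a subset of the vertices.\<close>

definition induced :: "'v graph \<Rightarrow> 'v set \<Rightarrow> 'v graph" where
  "induced G U = Graph U (edges_within G U)"

text \<open>A graph without cycles; no connectivity is required.\<close>

definition forest :: "'v graph \<Rightarrow> bool" where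
  "forest G \<longleftrightarrow> (\<nexists>c. cycle G c)"

lemma verts_induced [simp]: "verts (induced G U) = U"
  and edges_induced [simp]: "edges (induced G U) = edges_within G U"
  by (simp_all add: induced_def)

lemma sym_adj: "sym (adj G)"
  by (auto simp: adj_def sym_def insert_commute)

lemma adj_mono: "edges G \<subseteq> edges H \<Longrightarrow> adj G \<subseteq> adj H"
  by (auto simp: adj_def)

lemma simple_graph_adjD:
  assumes "simple_graph G" "(u, v) \<in> adj G"
  shows "u \<in> verts G" "v \<in> verts G" "u \<noteq> v"
  using assms by (auto simp: simple_graph_def adj_def card_insert_if)

lemma simple_graph_edgeE:
  assumes "simple_graph G" "e \<in> edges G"
  obtains a b where "e = {a, b}" "a \<noteq> b" "a \<in> verts G" "b \<in> verts G"
proof -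
  have "card e = 2" "e \<subseteq> verts G" using assms by (auto simp: simple_graph_def)
  then show ?thesis using that by (auto simp: card_2_iff)
qed

lemma finite_edges:
  assumes "finite_graph G" shows "finite (edges G)"
proof -
  have "edges G \<subseteq> Pow (verts G)" using assms by (auto simp: finite_graph_def simple_graph_def)
  then show ?thesis using assms finite_subset[of "edges G" "Pow (verts G)"] by (simp add: finite_graph_def)
qed

lemma simple_graph_induced: "simple_graph G \<Longrightarrow> simple_graph (induced G U)"
  by (auto simp: simple_graph_def edges_within_def)

lemma edges_within_mono:
  "edges G \<subseteq> edges H \<Longrightarrow> S \<subseteq> U \<Longrightarrow> edges_within G S \<subseteq> edges_within H U"
  by (auto simp: edges_within_def)

lemma cycle_mono: "cycle G c \<Longrightarrow> edges G \<subseteq> edges H \<Longrightarrow> cycle H c"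
  by (auto simp: cycle_def)

text \<open>
  A breadth-first spanning tree rooted at \<open>r\<close>, given by the map \<open>f\<close> from the other vertices to the
  edges towards their parents. Injectivity of \<open>f\<close> counts the edges of the tree.
\<close>

lemma spanning_tree:
  assumes "connected_graph G" "r \<in> verts G" "simple_graph G"
  obtains f where "inj_on f (verts G - {r})" "f ` (verts G - {r}) \<subseteq> edges G"
    "\<And>v. v \<in> verts G \<Longrightarrow> (r, v) \<in> (adj (Graph (verts G) (f ` (verts G - {r}))))\<^sup>*"
proof -
  define d where "d v = (LEAST k. (r, v) \<in> adj G ^^ k)" for v
  have d: "(r, v) \<in> adj G ^^ d v" if "v \<in> verts G" for v
  proof -
    have "\<exists>k. (r, v) \<in> adj G ^^ k"
      using assms that by (auto simp: connected_graph_def rtrancl_power)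
    then show ?thesis unfolding d_def by (rule LeastI_ex)
  qed
  have "\<exists>u. (u, v) \<in> adj G \<and> d u < d v" if v: "v \<in> verts G - {r}" for v
  proof -
    have "d v \<noteq> 0" using d[of v] v by (intro notI) simp
    then obtain k where k: "d v = Suc k" by (cases "d v") auto
    then obtain u where u: "(r, u) \<in> adj G ^^ k" "(u, v) \<in> adj G"
      using d[of v] v by auto
    then have "d u \<le> k" unfolding d_def by (auto intro: Least_le)
    then show ?thesis using u k by auto
  qed
  then obtain par where par: "(par v, v) \<in> adj G" "d (par v) < d v" if "v \<in> verts G - {r}" for v
    by metis
  define f where "f v = {par v, v}" for v
  have "inj_on f (verts G - {r})"
  proof (rule inj_onI)
    \<comment> \<open>Distinct vertices sharing a parent edge would be each other's parents, each nearer to \<open>r\<close> than the other.\<close>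
    fix v v' assume *: "v \<in> verts G - {r}" "v' \<in> verts G - {r}" "f v = f v'"
    then show "v = v'" using par(2)[of v] par(2)[of v']
      by (auto simp: f_def doubleton_eq_iff)
  qed
  moreover have "f ` (verts G - {r}) \<subseteq> edges G"
    using par(1) by (auto simp: f_def adj_def)
  moreover have "(r, v) \<in> (adj (Graph (verts G) (f ` (verts G - {r}))))\<^sup>*" if "v \<in> verts G" for v
    using that
  proof (induction "d v" arbitrary: v rule: less_induct)
    case less
    show ?case
    proof (cases "v = r")
      case False
      then have v: "v \<in> verts G - {r}" using less by auto
      have "(r, par v) \<in> (adj (Graph (verts G) (f ` (verts G - {r}))))\<^sup>*"
        using less par[OF v] simple_graph_adjD[OF assms(3)] by blast
      moreover have "(par v, v) \<in> adj (Graph (verts G) (f ` (verts G - {r})))"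
        using v by (auto simp: adj_def f_def)
      ultimately show ?thesis by (rule rtrancl_into_rtrancl)
    qed auto
  qed
  ultimately show ?thesis by (rule that)
qed

text \<open>
  An edge closes a cycle if its endpoints are joined without it: a shortest path between them that
  avoids the edge has distinct vertices and at least two steps.
\<close>

lemma cycle_if_bypass:
  assumes ab: "{a, b} \<in> edges G" "a \<noteq> b"
    and path: "(a, b) \<in> (adj (Graph V (edges G - {{a, b}})))\<^sup>*"
  shows "\<exists>c. cycle G c"
proof -
  let ?R = "adj (Graph V (edges G - {{a, b}}))"
  define n where "n = (LEAST k. (a, b) \<in> ?R ^^ k)"
  have "\<exists>k. (a, b) \<in> ?R ^^ k" using path by (simp add: rtrancl_power)
  then have "(a, b) \<in> ?R ^^ n" unfolding n_def by (rule LeastI_ex)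
  then obtain f where f: "f 0 = a" "f n = b" "\<And>i. i < n \<Longrightarrow> (f i, f (Suc i)) \<in> ?R"
    unfolding relpow_fun_conv by blast
  have "n \<noteq> 0" using f ab by (intro notI) simp
  moreover have "n \<noteq> 1" using f(1,2) f(3)[of 0] by (auto simp: adj_def)
  ultimately have n: "n \<ge> 2" by simp
  have inj: "f i \<noteq> f j" if "i < j" "j \<le> n" for i j
  proof
    assume eq: "f i = f j"
    have "(a, f i) \<in> ?R ^^ i"
      unfolding relpow_fun_conv using f that by (intro exI[of _ f]) auto
    moreover have "(f j, b) \<in> ?R ^^ (n - j)"
      unfolding relpow_fun_conv using f that by (intro exI[of _ "\<lambda>k. f (k + j)"]) auto
    ultimately have "(a, b) \<in> ?R ^^ (i + (n - j))"
      using eq by (auto simp: relpow_add)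
    then have "n \<le> i + (n - j)" unfolding n_def by (rule Least_le)
    then show False using that by linarith
  qed
  define c where "c = map f [0..<Suc n]"
  have len: "length c = Suc n" and nth: "\<And>i. i \<le> n \<Longrightarrow> c ! i = f i"
    by (auto simp: c_def simp del: upt_Suc)
  have "distinct c"
    unfolding distinct_conv_nth using inj len nth
    by (metis less_Suc_eq_le nat_neq_iff)
  moreover have "{c ! i, c ! (Suc i mod length c)} \<in> edges G" if "i < length c" for i
  proof (cases "i = n")
    case True
    then show ?thesis using len nth[of n] nth[of 0] f ab by (simp add: insert_commute)
  next
    case False
    then have "i < n" using that len by simp
    then show ?thesis using f(3)[of i] nth[of i] nth[of "Suc i"] len by (auto simp: adj_def)
  qed
  ultimately have "cycle G c" using len n by (simp add: cycle_def)
  then show ?thesis ..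
qed

lemma connected_graph_card_le:
  assumes "finite_graph G" "connected_graph G"
  shows "card (verts G) \<le> card (edges G) + 1"
proof -
  have fin: "finite (verts G)" and sg: "simple_graph G" using assms by (auto simp: finite_graph_def)
  obtain r where r: "r \<in> verts G" using assms by (auto simp: connected_graph_def)
  obtain f where f: "inj_on f (verts G - {r})" "f ` (verts G - {r}) \<subseteq> edges G"
    using spanning_tree[OF assms(2) r sg] by metis
  have "card (verts G - {r}) \<le> card (edges G)"
    using card_inj_on_le[OF f finite_edges[OF assms(1)]] .
  then show ?thesis using r fin by (simp add: card_Diff_singleton)
qed

lemma tree_card:
  assumes "finite_graph G" "tree G"
  shows "card (verts G) = card (edges G) + 1"
proof (rule antisym)
  have fin: "finite (verts G)" and sg: "simple_graph G" and con: "connected_graph G"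
    using assms by (auto simp: finite_graph_def tree_def)
  then show "card (verts G) \<le> card (edges G) + 1" using connected_graph_card_le assms by blast
  show "card (edges G) + 1 \<le> card (verts G)"
  proof (rule ccontr)
    assume *: "\<not> ?thesis"
    obtain r where r: "r \<in> verts G" using con by (auto simp: connected_graph_def)
    obtain f where f: "inj_on f (verts G - {r})" "f ` (verts G - {r}) \<subseteq> edges G"
      "\<And>v. v \<in> verts G \<Longrightarrow> (r, v) \<in> (adj (Graph (verts G) (f ` (verts G - {r}))))\<^sup>*"
      using spanning_tree[OF con r sg] by metis
    let ?T = "Graph (verts G) (f ` (verts G - {r}))"
    have "card (f ` (verts G - {r})) < card (edges G)"
      using * r fin f(1) card_gt_0_iff[of "verts G"] by (auto simp: card_image card_Diff_singleton)
    then have "f ` (verts G - {r}) \<noteq> edges G" by auto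
    \<comment> \<open>Some edge is not in the spanning tree, which joins the endpoints of that edge.\<close>
    then obtain e where e: "e \<in> edges G" "e \<notin> f ` (verts G - {r})" using f(2) by blast
    then obtain a b where ab: "e = {a, b}" "a \<noteq> b" "a \<in> verts G" "b \<in> verts G"
      using simple_graph_edgeE[OF sg] by metis
    have "(a, r) \<in> (adj ?T)\<^sup>*"
      using f(3)[of a] ab sym_rtrancl[OF sym_adj] by (metis symD)
    then have "(a, b) \<in> (adj ?T)\<^sup>*" using f(3)[of b] ab by auto
    moreover have "adj ?T \<subseteq> adj (Graph (verts G) (edges G - {{a, b}}))"
      using f(2) e ab by (intro adj_mono) auto
    ultimately have "(a, b) \<in> (adj (Graph (verts G) (edges G - {{a, b}})))\<^sup>*"
      using rtrancl_mono by blast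
    then have "\<exists>c. cycle G c" using cycle_if_bypass e ab by metis
    then show False using assms by (auto simp: tree_def)
  qed
qed

section \<open>Connected components\<close>

lemma equiv_connected_in: "equiv (verts G) (connected_in G)"
proof (rule equivI)
  show "refl_on (verts G) (connected_in G)" by (auto simp: refl_on_def connected_in_def)
  show "sym (connected_in G)"
    using sym_rtrancl[OF sym_adj, of G] by (auto simp: sym_def connected_in_def)
  show "trans (connected_in G)" by (auto simp: trans_def connected_in_def)
  show "connected_in G \<subseteq> verts G \<times> verts G" by (auto simp: connected_in_def)
qed

lemma Union_components_verts: "\<Union> (components G) = verts G"
  unfolding components_def by (rule Union_quotient[OF equiv_connected_in])

lemma components_disjoint:
  "C \<in> components G \<Longrightarrow> D \<in> components G \<Longrightarrow> C \<noteq> D \<Longrightarrow> C \<inter> D = {}"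
  unfolding components_def using quotient_disj[OF equiv_connected_in] by metis

lemma components_nonempty: "C \<in> components G \<Longrightarrow> C \<noteq> {}"
  unfolding components_def using in_quotient_imp_non_empty[OF equiv_connected_in] by metis

lemma components_adj_closed:
  assumes "simple_graph G" "C \<in> components G" "u \<in> C" "(u, v) \<in> adj G"
  shows "v \<in> C"
proof -
  have "(u, v) \<in> connected_in G"
    using assms simple_graph_adjD[OF assms(1,4)] by (auto simp: connected_in_def)
  then show ?thesis
    using assms in_quotient_imp_closed[OF equiv_connected_in] unfolding components_def by metis
qed

lemma component_connected:
  assumes "simple_graph G" "C \<in> components G"
  shows "connected_graph (induced G C)"
proof -
  have "(u, v) \<in> (adj (induced G C))\<^sup>*" if uv: "u \<in> C" "v \<in> C" for u v
  proof -
    have "(u, v) \<in> connected_in G"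
      using assms uv unfolding components_def
      by (intro in_quotient_imp_in_rel[OF equiv_connected_in]) simp_all
    then have "(u, v) \<in> (adj G)\<^sup>*" by (auto simp: connected_in_def)
    then have "v \<in> C \<and> (u, v) \<in> (adj (induced G C))\<^sup>*"
    proof induction
      case (step y z)
      then have "z \<in> C" using components_adj_closed[OF assms] by blast
      then have "(y, z) \<in> adj (induced G C)"
        using step.hyps(2) step.IH \<open>z \<in> C\<close> by (simp add: adj_def edges_within_def)
      then show ?case using step.IH \<open>z \<in> C\<close> rtrancl_into_rtrancl by metis
    qed (simp add: uv)
    then show ?thesis ..
  qed
  then show ?thesis using components_nonempty[OF assms(2)] by (simp add: connected_graph_def)
qed

lemma edge_within_component:
  assumes "simple_graph G" "e \<in> edges G" "C \<in> components G" "e \<inter> C \<noteq> {}"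
  shows "e \<subseteq> C"
proof -
  obtain a b where ab: "e = {a, b}" using simple_graph_edgeE[OF assms(1,2)] by metis
  then have "(a, b) \<in> adj G" "(b, a) \<in> adj G" using assms(2) by (simp_all add: adj_def insert_commute)
  then have "b \<in> C \<longleftrightarrow> a \<in> C" using components_adj_closed[OF assms(1,3)] by metis
  then show ?thesis using assms(4) ab by auto
qed

lemma components_subset: "C \<in> components G \<Longrightarrow> C \<subseteq> verts G"
  using Union_upper[of C "components G"] by (simp add: Union_components_verts)

lemma finite_components: "finite_graph G \<Longrightarrow> finite (components G)"
  using components_subset[of _ G] finite_subset[of "components G" "Pow (verts G)"]
  by (auto simp: finite_graph_def)

lemma finite_graph_component:
  "finite_graph G \<Longrightarrow> C \<in> components G \<Longrightarrow> finite_graph (induced G C)"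
  using finite_subset[OF components_subset, of C G]
  by (auto simp: finite_graph_def simple_graph_induced)

lemma component_subset_closed:
  assumes "simple_graph G" "C \<in> components G"
    and closed: "\<And>u v. (u, v) \<in> adj G \<Longrightarrow> u \<in> S \<Longrightarrow> v \<in> S"
    and "C \<inter> S \<noteq> {}"
  shows "C \<subseteq> S"
proof
  fix v assume v: "v \<in> C"
  obtain u where u: "u \<in> C" "u \<in> S" using assms(4) by auto
  have "(u, v) \<in> (adj (induced G C))\<^sup>*"
    using component_connected[OF assms(1,2)] u v by (simp add: connected_graph_def)
  then show "v \<in> S"
  proof induction
    case (step y z)
    then have "(y, z) \<in> adj G" by (simp add: adj_def edges_within_def)
    then show ?case using closed step by metis
  qed (rule u)
qed

lemma card_Union_components:
  assumes "finite_graph G" "K \<subseteq> components G"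
  shows "card (\<Union>K) = (\<Sum>C\<in>K. card C)"
proof (rule card_Union_disjoint)
  show "pairwise disjnt K"
    using components_disjoint assms(2) unfolding pairwise_def disjnt_def by blast
  show "finite C" if "C \<in> K" for C
    using finite_graph_component[OF assms(1), of C] that assms(2) by (auto simp: finite_graph_def)
qed

lemma card_edges_within_Union_components:
  assumes "finite_graph G" "K \<subseteq> components G"
  shows "card (edges_within G (\<Union>K)) = (\<Sum>C\<in>K. card (edges_within G C))"
proof -
  have sg: "simple_graph G" using assms by (simp add: finite_graph_def)
  have nonempty: "e \<noteq> {}" if "e \<in> edges G" for e
    using simple_graph_edgeE[OF sg that] by auto
  have "edges_within G (\<Union>K) = (\<Union>C\<in>K. edges_within G C)"
  proof (intro equalityI subsetI)
    fix e assume e: "e \<in> edges_within G (\<Union>K)"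
    then have eG: "e \<in> edges G" and "e \<subseteq> \<Union>K" by (auto simp: edges_within_def)
    then obtain C where C: "C \<in> K" "e \<inter> C \<noteq> {}" using nonempty[OF eG] by blast
    then have "e \<subseteq> C" using edge_within_component[OF sg eG, of C] assms(2) by blast
    then show "e \<in> (\<Union>C\<in>K. edges_within G C)" using C(1) eG by (auto simp: edges_within_def)
  qed (auto simp: edges_within_def)
  moreover have "card (\<Union>C\<in>K. edges_within G C) = (\<Sum>C\<in>K. card (edges_within G C))"
  proof (rule card_UN_disjoint)
    show "finite K" using finite_subset[OF assms(2) finite_components[OF assms(1)]] .
    show "\<forall>C\<in>K. finite (edges_within G C)"
      using finite_edges[OF assms(1)] by (simp add: edges_within_def)
    show "\<forall>C\<in>K. \<forall>D\<in>K. C \<noteq> D \<longrightarrow> edges_within G C \<inter> edges_within G D = {}"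
    proof (intro ballI impI)
      fix C D assume CD: "C \<in> K" "D \<in> K" "C \<noteq> D"
      then have "C \<inter> D = {}" using components_disjoint[of C G D] assms(2) by blast
      then have "e = {}" if "e \<subseteq> C" "e \<subseteq> D" for e using that by blast
      then show "edges_within G C \<inter> edges_within G D = {}"
        using nonempty by (auto simp: edges_within_def)
    qed
  qed
  ultimately show ?thesis by simp
qed

text \<open>
  The vertex sets \<open>S\<close> that no edge of \<open>G\<close> leaves are exactly the complements of the unions of
  families of components. Hence a sum over such \<open>S\<close> of a function of the complement that is multiplicative over
  components is a product over the components.
\<close>

lemma sum_monochromatic_components:
  fixes h :: "'v set \<Rightarrow> real"
  assumes fin: "finite_graph G"
    and mult: "\<And>K. K \<subseteq> components G \<Longrightarrow> h (\<Union>K) = (\<Prod>C\<in>K. h C)"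
  shows "(\<Sum>S | S \<subseteq> verts G \<and> (\<forall>e\<in>edges G. e \<subseteq> S \<or> e \<subseteq> verts G - S). h (verts G - S)) =
    (\<Prod>C\<in>components G. h C + 1)"
proof -
  have sg: "simple_graph G" using fin by (simp add: finite_graph_def)
  define \<S> where "\<S> = {S. S \<subseteq> verts G \<and> (\<forall>e\<in>edges G. e \<subseteq> S \<or> e \<subseteq> verts G - S)}"
  have mono: "C \<subseteq> S \<or> C \<inter> S = {}" if S: "S \<in> \<S>" and C: "C \<in> components G" for S C
  proof -
    have "v \<in> S" if "(u, v) \<in> adj G" "u \<in> S" for u v
    proof -
      have "{u, v} \<in> edges G" using that by (simp add: adj_def)
      moreover have "\<forall>e\<in>edges G. e \<subseteq> S \<or> e \<subseteq> verts G - S" using S by (simp add: \<S>_def)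
      ultimately have "{u, v} \<subseteq> S \<or> {u, v} \<subseteq> verts G - S" by (rule bspec[rotated])
      then show ?thesis using that(2) by auto
    qed
    then show ?thesis using component_subset_closed[OF sg C, of S] by metis
  qed
  have 1: "verts G - \<Union>{C \<in> components G. C \<inter> S = {}} = S" if S: "S \<in> \<S>" for S
  proof (intro equalityI subsetI)
    fix v assume v: "v \<in> verts G - \<Union>{C \<in> components G. C \<inter> S = {}}"
    then obtain C where "C \<in> components G" "v \<in> C" using Union_components_verts[of G] by auto
    then show "v \<in> S" using mono[OF S] v by blast
  qed (use S in \<open>auto simp: \<S>_def\<close>)
  have 2: "verts G - \<Union>K \<in> \<S>" if K: "K \<subseteq> components G" for K
  proof -
    have "e \<subseteq> verts G - \<Union>K \<or> e \<subseteq> \<Union>K" if e: "e \<in> edges G" for e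
    proof -
      have "e \<subseteq> verts G" using sg e by (simp add: simple_graph_def)
      then show ?thesis using edge_within_component[OF sg e] K by blast
    qed
    moreover have "\<Union>K \<subseteq> verts G" using Union_mono[OF K] by (simp add: Union_components_verts)
    then have "verts G - (verts G - \<Union>K) = \<Union>K" by (rule double_diff) simp
    ultimately show ?thesis by (auto simp: \<S>_def)
  qed
  have 3: "{C \<in> components G. C \<inter> (verts G - \<Union>K) = {}} = K" if K: "K \<subseteq> components G" for K
  proof (intro equalityI subsetI)
    fix C assume C: "C \<in> {C \<in> components G. C \<inter> (verts G - \<Union>K) = {}}"
    then obtain v where v: "v \<in> C" using components_nonempty[of C G] by auto
    then have "v \<in> \<Union>K" using C components_subset[of C G] by auto
    then obtain D where "D \<in> K" "v \<in> D" by auto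
    then show "C \<in> K" using components_disjoint[of C G D] C v K by auto
  qed (use K components_subset in auto)
  have "(\<Sum>S\<in>\<S>. h (verts G - S)) = (\<Sum>K\<in>Pow (components G). h (\<Union>K))"
  proof (rule sum.reindex_bij_witness[where i = "\<lambda>K. verts G - \<Union>K"
        and j = "\<lambda>S. {C \<in> components G. C \<inter> S = {}}"])
    fix S assume S: "S \<in> \<S>"
    have "\<Union>{C \<in> components G. C \<inter> S = {}} \<subseteq> verts G" using components_subset by auto
    then have "\<Union>{C \<in> components G. C \<inter> S = {}} = verts G - S" using 1[OF S] by auto
    then show "h (\<Union>{C \<in> components G. C \<inter> S = {}}) = h (verts G - S)" by simp
  qed (use 1 2 3 in auto)
  also have "\<dots> = (\<Sum>K\<in>Pow (components G). (\<Prod>C\<in>K. h C) * (\<Prod>C\<in>components G - K. 1))"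
    by (intro sum.cong) (auto simp: mult)
  also have "\<dots> = (\<Prod>C\<in>components G. h C + 1)"
    using prod_add[OF finite_components[OF fin], of h "\<lambda>_. 1"] by simp
  finally show ?thesis by (simp add: \<S>_def)
qed

section \<open>Expansion of both partition functions over edge sets\<close>

lemma Z_expansion:
  assumes fin: "finite_graph G"
  shows "Z G q w B = (\<Sum>A\<in>Pow (edges G). w ^ card A *
     (\<Prod>C\<in>components (Graph (verts G) A). 1 + (q - 1) * exp (- B * real (card C))))"
  unfolding Z_def
proof (rule sum.reindex_bij_witness[where
      i = "\<lambda>A. \<lambda>e\<in>edges G. if e \<in> A then 1 else 0" and j = "\<lambda>\<omega>. {e \<in> edges G. \<omega> e = 1}"])
  fix \<omega> :: "'a set \<Rightarrow> nat" assume \<omega>: "\<omega> \<in> edges G \<rightarrow>\<^sub>E {0, 1}"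
  then have v: "\<omega> e = 0 \<or> \<omega> e = 1" if "e \<in> edges G" for e using that by auto
  show "(\<lambda>e\<in>edges G. if e \<in> {e \<in> edges G. \<omega> e = 1} then 1 else 0) = \<omega>"
    using \<omega> v by (auto simp: fun_eq_iff restrict_def PiE_def extensional_def)
  show "{e \<in> edges G. \<omega> e = 1} \<in> Pow (edges G)" by auto
  have "(\<Prod>e\<in>edges G. w ^ \<omega> e) = (\<Prod>e\<in>edges G. if \<omega> e = 1 then w else 1)"
    by (intro prod.cong refl) (metis v power_0 power_one_right)
  also have "\<dots> = w ^ card {e \<in> edges G. \<omega> e = 1}"
    using prod.inter_filter[OF finite_edges[OF fin], of "\<lambda>_. w" "\<lambda>e. \<omega> e = 1"] by simp
  finally show "w ^ card {e \<in> edges G. \<omega> e = 1} *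
      (\<Prod>C\<in>components (Graph (verts G) {e \<in> edges G. \<omega> e = 1}).
        1 + (q - 1) * exp (- B * real (card C))) =
      (\<Prod>e\<in>edges G. w ^ \<omega> e) *
        (\<Prod>C\<in>components (open_subgraph G \<omega>). 1 + (q - 1) * exp (- B * real (card C)))"
    by (simp add: open_subgraph_def)
next
  fix A assume "A \<in> Pow (edges G)"
  then show "{e \<in> edges G. (\<lambda>e\<in>edges G. if e \<in> A then 1 else 0) e = (1::nat)} = A" by auto
  show "(\<lambda>e\<in>edges G. if e \<in> A then 1 else 0) \<in> edges G \<rightarrow>\<^sub>E {0, 1::nat}" by auto
qed

lemma finite_graph_spanning_subgraph:
  "finite_graph G \<Longrightarrow> A \<subseteq> edges G \<Longrightarrow> finite_graph (Graph (verts G) A)"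
  by (auto simp: finite_graph_def simple_graph_def)

text \<open>
  In the numerator, \<open>(q - 1)^|C|\<close> and the edge count in the denominator together stand for
  \<open>(q - 1)^(|C| - |A(C)|)\<close>, whose exponent may be negative.
\<close>

lemma Z2_expansion:
  fixes q w B :: real
  assumes fin: "finite_graph G" and q: "q > 1"
  shows "Z2 G q w B = (\<Sum>A\<in>Pow (edges G). w ^ card A *
     (\<Prod>C\<in>components (Graph (verts G) A).
        ((q - 1) * exp (- B)) ^ card C / (q - 1) ^ card (edges_within (Graph (verts G) A) C) + 1))"
proof -
  let ?V = "verts G"
  let ?E = "edges G"
  define p where "p = q - 1"
  have p: "p > 0" using q by (simp add: p_def)
  define h where "h A T = (p * exp (- B)) ^ card T / p ^ card {e \<in> A. e \<subseteq> T}" for A :: "'a set set" and T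
  have finV: "finite ?V" and finE: "finite ?E" and sg: "simple_graph G"
    using fin finite_edges[OF fin] by (auto simp: finite_graph_def)
  have ew: "edges_within (Graph ?V A) T = {e \<in> A. e \<subseteq> T}" for A T by (simp add: edges_within_def)
  define ok where "ok S A \<longleftrightarrow> (\<forall>e\<in>A. e \<subseteq> S \<or> e \<subseteq> ?V - S)" for S and A :: "'a set set"
  have "Z2 G q w B = (\<Sum>S\<in>Pow ?V. \<Sum>A\<in>{A \<in> Pow ?E. ok S A}. w ^ card A * h A (?V - S))"
    unfolding Z2_def
  proof (rule sum.cong[OF refl])
    fix S assume S: "S \<in> Pow ?V"
    let ?F1 = "edges_within G S" and ?F2 = "edges_within G (?V - S)"
    have nonempty: "e \<noteq> {}" if "e \<in> ?E" for e using simple_graph_edgeE[OF sg that] by auto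
    have disj: "?F1 \<inter> ?F2 = {}"
      using nonempty by (auto simp: edges_within_def)
    have fin12: "finite ?F1" "finite ?F2" using finE by (auto simp: edges_within_def)
    \<comment> \<open>The summand at \<open>S\<close> is a product of \<open>g e + 1\<close> over the edges that do not cross between \<open>S\<close> and
      its complement; expanding it sums over all sets \<open>A\<close> of such edges.\<close>
    define g where "g e = (if e \<subseteq> S then w else w / p)" for e
    have ok_iff: "{A \<in> Pow ?E. ok S A} = Pow (?F1 \<union> ?F2)"
      by (auto simp: ok_def edges_within_def)
    have "(1 + w) ^ card ?F1 * (1 + w / p) ^ card ?F2 = (\<Prod>e\<in>?F1. g e + 1) * (\<Prod>e\<in>?F2. g e + 1)"
    proof -
      have "(\<Prod>e\<in>?F1. g e + 1) = (\<Prod>e\<in>?F1. 1 + w)"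
        by (intro prod.cong) (auto simp: g_def edges_within_def)
      moreover have "(\<Prod>e\<in>?F2. g e + 1) = (\<Prod>e\<in>?F2. 1 + w / p)"
        using disj by (intro prod.cong) (auto simp: g_def edges_within_def)
      ultimately show ?thesis by simp
    qed
    also have "\<dots> = (\<Prod>e\<in>?F1 \<union> ?F2. g e + 1)"
      by (rule prod.union_disjoint[OF fin12 disj, symmetric])
    also have "\<dots> = (\<Sum>A\<in>Pow (?F1 \<union> ?F2). \<Prod>e\<in>A. g e)"
      using prod_add[of "?F1 \<union> ?F2" g "\<lambda>_. 1"] fin12 by simp
    finally have eq: "(1 + w) ^ card ?F1 * (1 + w / p) ^ card ?F2 =
        (\<Sum>A\<in>Pow (?F1 \<union> ?F2). \<Prod>e\<in>A. g e)" .
    have prod_g: "(\<Prod>e\<in>A. g e) = w ^ card A / p ^ card {e \<in> A. e \<subseteq> ?V - S}"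
      if A: "A \<in> Pow (?F1 \<union> ?F2)" for A
    proof -
      have finA: "finite A" using A fin12 finite_subset by auto
      have "(\<Prod>e\<in>A. g e) = (\<Prod>e\<in>A. w * (if e \<subseteq> ?V - S then 1 / p else 1))"
      proof (rule prod.cong[OF refl])
        fix e assume "e \<in> A"
        then have "e \<in> ?F1 \<and> e \<notin> ?F2 \<or> e \<in> ?F2 \<and> e \<notin> ?F1" using A disj by blast
        then show "g e = w * (if e \<subseteq> ?V - S then 1 / p else 1)"
          unfolding g_def edges_within_def by auto
      qed
      also have "\<dots> = w ^ card A * (\<Prod>e\<in>A. if e \<subseteq> ?V - S then 1 / p else 1)"
        by (simp add: prod.distrib)
      also have "(\<Prod>e\<in>A. if e \<subseteq> ?V - S then 1 / p else 1) = (1 / p) ^ card {e \<in> A. e \<subseteq> ?V - S}"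
        using prod.inter_filter[OF finA, of "\<lambda>_. 1 / p" "\<lambda>e. e \<subseteq> ?V - S"] by simp
      finally show ?thesis by (simp add: power_divide)
    qed
    have "card ?V - card S = card (?V - S)"
      using S finV by (simp add: card_Diff_subset finite_subset)
    then have "(1 + w) ^ card ?F1 * (1 + w / (q - 1)) ^ card ?F2 *
        ((q - 1) * exp (- B)) ^ (card ?V - card S) =
        (\<Sum>A\<in>Pow (?F1 \<union> ?F2). \<Prod>e\<in>A. g e) * (p * exp (- B)) ^ card (?V - S)"
      using eq by (simp add: p_def)
    also have "\<dots> = (\<Sum>A\<in>Pow (?F1 \<union> ?F2). w ^ card A * h A (?V - S))"
      unfolding sum_distrib_right by (intro sum.cong) (auto simp: prod_g h_def)
    finally show "(1 + w) ^ card ?F1 * (1 + w / (q - 1)) ^ card ?F2 *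
        ((q - 1) * exp (- B)) ^ (card ?V - card S) =
        (\<Sum>A\<in>{A \<in> Pow ?E. ok S A}. w ^ card A * h A (?V - S))"
      unfolding ok_iff .
  qed
  also have "\<dots> = (\<Sum>A\<in>Pow ?E. \<Sum>S\<in>{S \<in> Pow ?V. ok S A}. w ^ card A * h A (?V - S))"
    by (rule sum.swap_restrict) (use finV finE in auto)
  also have "\<dots> = (\<Sum>A\<in>Pow ?E. w ^ card A * (\<Prod>C\<in>components (Graph ?V A). h A C + 1))"
  proof (rule sum.cong[OF refl])
    fix A assume "A \<in> Pow ?E"
    then have finH: "finite_graph (Graph ?V A)" using finite_graph_spanning_subgraph[OF fin] by auto
    have "h A (\<Union>K) = (\<Prod>C\<in>K. h A C)" if K: "K \<subseteq> components (Graph ?V A)" for K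
      using card_Union_components[OF finH K] card_edges_within_Union_components[OF finH K]
      by (simp add: h_def ew prod_dividef power_sum)
    from sum_monochromatic_components[OF finH, of "h A", OF this]
    have "(\<Sum>S\<in>{S \<in> Pow ?V. ok S A}. h A (?V - S)) = (\<Prod>C\<in>components (Graph ?V A). h A C + 1)"
      by (simp add: ok_def)
    then show "(\<Sum>S\<in>{S \<in> Pow ?V. ok S A}. w ^ card A * h A (?V - S)) =
        w ^ card A * (\<Prod>C\<in>components (Graph ?V A). h A C + 1)"
      by (simp add: sum_distrib_left[symmetric])
  qed
  finally show ?thesis by (simp add: h_def ew p_def)
qed

section \<open>Components that are not trees\<close>

text \<open>The vertices of \<open>G\<close> that have a cycle in their neighbourhood of radius \<open>r\<close>.\<close>

definition cyclic_verts :: "'v graph \<Rightarrow> nat \<Rightarrow> 'v set" where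
  "cyclic_verts G r = {v \<in> verts G. \<not> forest (fst (nbhd G r v))}"

text \<open>The components, as vertex sets, that do not induce a tree.\<close>

definition nontree_components :: "'v graph \<Rightarrow> 'v set set" where
  "nontree_components G = {C \<in> components G. \<not> tree (induced G C)}"

text \<open>
  Any two vertices of a component \<open>C\<close> are joined by a path with at most as many steps as there are
  adjacent ordered pairs in \<open>C\<close>. This is at most \<open>|C|\<^sup>2\<close>, a crude bound for the distance that suffices:
  the neighbourhood of radius \<open>R\<^sup>2\<close> of a vertex of \<open>C\<close> contains all of \<open>C\<close>.
\<close>

lemma nontree_component_subset_cyclic_verts:
  assumes fin: "finite_graph G" and A: "A \<subseteq> edges G"
    and C: "C \<in> nontree_components (Graph (verts G) A)" and R: "card C \<le> R"
  shows "C \<subseteq> cyclic_verts G (R\<^sup>2)"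
proof
  fix v assume v: "v \<in> C"
  let ?H = "Graph (verts G) A"
  have finH: "finite_graph ?H" using finite_graph_spanning_subgraph[OF fin A] .
  then have sH: "simple_graph ?H" by (simp add: finite_graph_def)
  have CH: "C \<in> components ?H" and nt: "\<not> tree (induced ?H C)"
    using C by (auto simp: nontree_components_def)
  have CV: "C \<subseteq> verts G" using components_subset[OF CH] by simp
  have finC: "finite C" using finite_graph_component[OF finH CH] by (simp add: finite_graph_def)
  have con: "connected_graph (induced ?H C)" using component_connected[OF sH CH] .
  then obtain c where c: "cycle (induced ?H C) c" using nt by (auto simp: tree_def)
  let ?U = "{u \<in> verts G. \<exists>k\<le>R\<^sup>2. (v, u) \<in> adj G ^^ k}"
  let ?R = "adj (induced ?H C)"
  have sub: "?R \<subseteq> C \<times> C" by (auto simp: adj_def edges_within_def)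
  have finR: "finite ?R" using finite_subset[OF sub] finC by simp
  have "card ?R \<le> card (C \<times> C)" using card_mono[OF _ sub] finC by simp
  also have "\<dots> \<le> R\<^sup>2" using R by (simp add: card_cartesian_product power2_eq_square mult_le_mono)
  finally have cardR: "card ?R \<le> R\<^sup>2" .
  have "?R \<subseteq> adj G" using A by (intro adj_mono) (auto simp: edges_within_def)
  have "C \<subseteq> ?U"
  proof
    fix u assume u: "u \<in> C"
    have "(v, u) \<in> ?R\<^sup>*" using con u v by (simp add: connected_graph_def)
    then obtain k where k: "k \<le> card ?R" "(v, u) \<in> ?R ^^ k"
      using rtrancl_finite_eq_relpow[OF finR] by auto
    then have "(v, u) \<in> adj G ^^ k" using \<open>?R \<subseteq> adj G\<close> unfolding relpow_fun_conv by blast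
    moreover have "k \<le> R\<^sup>2" using k(1) cardR by (rule le_trans)
    ultimately show "u \<in> ?U" using u CV by auto
  qed
  then have "edges_within ?H C \<subseteq> edges_within G ?U"
    using A by (intro edges_within_mono) simp_all
  then have "edges (induced ?H C) \<subseteq> edges (fst (nbhd G (R\<^sup>2) v))"
    by (simp add: nbhd_def Let_def)
  then have "cycle (fst (nbhd G (R\<^sup>2) v)) c" using cycle_mono[OF c] by metis
  then show "v \<in> cyclic_verts G (R\<^sup>2)" using v CV by (auto simp: cyclic_verts_def forest_def)
qed

lemma card_nontree_components_le:
  assumes fin: "finite_graph G" and A: "A \<subseteq> edges G" and R: "R \<ge> 1"
  shows "real (card (nontree_components (Graph (verts G) A))) \<le>
    real (card (verts G)) / real R + real (card (cyclic_verts G (R\<^sup>2)))"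
proof -
  let ?H = "Graph (verts G) A"
  have finH: "finite_graph ?H" using finite_graph_spanning_subgraph[OF fin A] .
  have finV: "finite (verts G)" using fin by (simp add: finite_graph_def)
  define big where "big = {C \<in> nontree_components ?H. card C > R}"
  define small where "small = {C \<in> nontree_components ?H. card C \<le> R}"
  have comp: "big \<subseteq> components ?H" "small \<subseteq> components ?H"
    by (auto simp: big_def small_def nontree_components_def)
  have finbs: "finite big" "finite small"
    using comp finite_components[OF finH] finite_subset by auto
  have "card big * R \<le> (\<Sum>C\<in>big. card C)"
    using sum_bounded_below[of big R card] by (auto simp: big_def)
  also have "\<dots> = card (\<Union>big)" using card_Union_components[OF finH comp(1)] by simp
  also have "\<dots> \<le> card (verts G)"
  proof (rule card_mono[OF finV])
    show "\<Union>big \<subseteq> verts G" using components_subset[of _ ?H] comp(1) by (auto simp: subset_iff)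
  qed
  finally have "real (card big) * real R \<le> real (card (verts G))"
    by (metis of_nat_le_iff of_nat_mult)
  then have 1: "real (card big) \<le> real (card (verts G)) / real R"
    using R by (simp add: pos_le_divide_eq)
  have "\<exists>v. v \<in> C" if "C \<in> small" for C
    using components_nonempty[of C ?H] comp(2) that by auto
  then obtain f where f: "f C \<in> C" if "C \<in> small" for C by metis
  have "card small \<le> card (cyclic_verts G (R\<^sup>2))"
  proof (rule card_inj_on_le)
    show "inj_on f small"
    proof (rule inj_onI)
      fix C D assume CD: "C \<in> small" "D \<in> small" "f C = f D"
      then have "C \<inter> D \<noteq> {}" using f by (metis disjoint_iff)
      then show "C = D" using components_disjoint[of C ?H D] CD comp(2) by auto
    qed
    show "f ` small \<subseteq> cyclic_verts G (R\<^sup>2)"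
    proof
      fix v assume "v \<in> f ` small"
      then obtain C where C: "C \<in> small" "v \<in> C" using f by auto
      then show "v \<in> cyclic_verts G (R\<^sup>2)"
        using nontree_component_subset_cyclic_verts[OF fin A, of C R] by (auto simp: small_def)
    qed
    show "finite (cyclic_verts G (R\<^sup>2))" using finV by (simp add: cyclic_verts_def)
  qed
  moreover have "nontree_components ?H = big \<union> small" by (auto simp: big_def small_def)
  then have "card (nontree_components ?H) \<le> card big + card small" using card_Un_le by metis
  ultimately show ?thesis using 1 by linarith
qed

section \<open>Comparison of the partition functions\<close>

context
  fixes q w B :: real
  assumes q: "q \<ge> 2" and w: "w \<ge> 0" and B: "B \<ge> 0"
begin

text \<open>
  The left-hand side is a factor of \<open>Z2\<close>, the right-hand side one of \<open>Z\<close>. Connectedness of \<open>C\<close> bounds the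
  exponent \<open>|C| - |A(C)|\<close> of \<open>q - 1 \<ge> 1\<close> by \<open>1\<close>.
\<close>

lemma Z2_factor_le_Z_factor:
  assumes "finite_graph H" "C \<in> components H"
  shows "((q - 1) * exp (- B)) ^ card C / (q - 1) ^ card (edges_within H C) + 1
    \<le> 1 + (q - 1) * exp (- B * real (card C))"
proof -
  have sH: "simple_graph H" using assms by (simp add: finite_graph_def)
  have "card C \<le> card (edges_within H C) + 1"
    using connected_graph_card_le[OF finite_graph_component[OF assms] component_connected[OF sH assms(2)]]
    by simp
  then have "(q - 1) ^ card C \<le> (q - 1) ^ (card (edges_within H C) + 1)"
    using q by (intro power_increasing) auto
  then have "(q - 1) ^ card C / (q - 1) ^ card (edges_within H C) \<le> q - 1"
    using q by (simp add: divide_le_eq)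
  then have "(q - 1) ^ card C / (q - 1) ^ card (edges_within H C) * exp (- B * real (card C)) \<le>
      (q - 1) * exp (- B * real (card C))"
    by (rule mult_right_mono) simp
  then show ?thesis
    by (simp add: power_mult_distrib exp_of_nat_mult[symmetric] mult_ac)
qed

text \<open>Conversely, a tree costs nothing, and any other component costs at most a factor \<open>q\<close>.\<close>

lemma Z_factor_le_Z2_factor:
  assumes "finite_graph H" "C \<in> components H"
  shows "1 + (q - 1) * exp (- B * real (card C)) \<le>
    (((q - 1) * exp (- B)) ^ card C / (q - 1) ^ card (edges_within H C) + 1) *
    (if C \<in> nontree_components H then q else 1)"
proof (cases "C \<in> nontree_components H")
  case True
  have "(q - 1) * exp (- B * real (card C)) \<le> (q - 1) * 1"
    using q B by (intro mult_left_mono) auto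
  then have "1 + (q - 1) * exp (- B * real (card C)) \<le> 1 * q" by simp
  also have "\<dots> \<le> (((q - 1) * exp (- B)) ^ card C / (q - 1) ^ card (edges_within H C) + 1) * q"
    using q by (intro mult_right_mono) auto
  finally show ?thesis using True by simp
next
  case False
  then have "tree (induced H C)" using assms by (simp add: nontree_components_def)
  then have "card C = card (edges_within H C) + 1"
    using tree_card[OF finite_graph_component[OF assms]] by simp
  then have "(q - 1) ^ card C / (q - 1) ^ card (edges_within H C) = q - 1"
    using q by simp
  moreover have "((q - 1) * exp (- B)) ^ card C / (q - 1) ^ card (edges_within H C) =
      (q - 1) ^ card C / (q - 1) ^ card (edges_within H C) * exp (- B * real (card C))"
    by (simp add: power_mult_distrib exp_of_nat_mult[symmetric] mult_ac)
  ultimately show ?thesis using False by simp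
qed

text \<open>The summand at \<open>S = {}\<close> is positive, and the others are nonnegative.\<close>

lemma Z2_pos:
  fixes G :: "'v graph"
  assumes fin: "finite_graph G" shows "Z2 G q w B > 0"
proof -
  have "1 + w / (q - 1) > 0" using q w by (intro add_pos_nonneg) auto
  then have "0 < (1 + w) ^ card (edges_within G {}) *
        (1 + w / (q - 1)) ^ card (edges_within G (verts G - {})) *
        ((q - 1) * exp (- B)) ^ (card (verts G) - card ({} :: 'v set))"
    using q w by (intro mult_pos_pos zero_less_power) auto
  also have "\<dots> \<le> Z2 G q w B"
    unfolding Z2_def using fin q w by (intro member_le_sum) (auto simp: finite_graph_def)
  finally show ?thesis .
qed

lemma Z2_le_Z:
  assumes fin: "finite_graph G" shows "Z2 G q w B \<le> Z G q w B"
proof -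
  have q1: "q > 1" using q by simp
  show ?thesis
    unfolding Z2_expansion[OF fin q1] Z_expansion[OF fin]
  proof (intro sum_mono mult_left_mono prod_mono conjI)
    fix A C assume "A \<in> Pow (edges G)" "C \<in> components (Graph (verts G) A)"
    then show "((q - 1) * exp (- B)) ^ card C /
        (q - 1) ^ card (edges_within (Graph (verts G) A) C) + 1 \<le>
        1 + (q - 1) * exp (- B * real (card C))"
      using Z2_factor_le_Z_factor[OF finite_graph_spanning_subgraph[OF fin]] by auto
  qed (use q w in auto)
qed

lemma Z_le_Z2:
  assumes fin: "finite_graph G" and R: "R \<ge> 1"
  shows "Z G q w B \<le>
    Z2 G q w B * q powr (real (card (verts G)) / real R + real (card (cyclic_verts G (R\<^sup>2))))"
proof -
  have q1: "q > 1" using q by simp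
  let ?x = "real (card (verts G)) / real R + real (card (cyclic_verts G (R\<^sup>2)))"
  let ?f = "\<lambda>H C. ((q - 1) * exp (- B)) ^ card C / (q - 1) ^ card (edges_within H C) + 1"
  have "(\<Prod>C\<in>components H. 1 + (q - 1) * exp (- B * real (card C))) \<le>
      (\<Prod>C\<in>components H. ?f H C) * q powr ?x" if A: "A \<subseteq> edges G" and H: "H = Graph (verts G) A" for A H
  proof -
    have finH: "finite_graph H" using finite_graph_spanning_subgraph[OF fin A] H by simp
    have nt: "{C \<in> components H. C \<in> nontree_components H} = nontree_components H"
      by (auto simp: nontree_components_def)
    have "(\<Prod>C\<in>components H. 1 + (q - 1) * exp (- B * real (card C))) \<le>
      (\<Prod>C\<in>components H. ?f H C * (if C \<in> nontree_components H then q else 1))"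
      using Z_factor_le_Z2_factor[OF finH] q by (intro prod_mono) auto
    also have "\<dots> = (\<Prod>C\<in>components H. ?f H C) * q ^ card (nontree_components H)"
      using prod.inter_filter[OF finite_components[OF finH], of "\<lambda>_. q" "\<lambda>C. C \<in> nontree_components H"]
      by (simp add: prod.distrib nt)
    also have "q ^ card (nontree_components H) = q powr real (card (nontree_components H))"
      using q by (simp add: powr_realpow)
    also have "(\<Prod>C\<in>components H. ?f H C) * \<dots> \<le> (\<Prod>C\<in>components H. ?f H C) * q powr ?x"
      using q card_nontree_components_le[OF fin A R] H
      by (intro mult_left_mono powr_mono prod_nonneg) auto
    finally show ?thesis .
  qed
  then show ?thesis
    unfolding Z2_expansion[OF fin q1] Z_expansion[OF fin] sum_distrib_right mult.assoc
    using w by (intro sum_mono mult_left_mono) auto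
qed

lemma ln_Z_diff:
  assumes fin: "finite_graph G" and R: "R \<ge> 1"
  shows "\<bar>ln (Z G q w B) - ln (Z2 G q w B)\<bar> \<le>
    (real (card (verts G)) / real R + real (card (cyclic_verts G (R\<^sup>2)))) * ln q"
proof -
  let ?x = "real (card (verts G)) / real R + real (card (cyclic_verts G (R\<^sup>2)))"
  have pos: "Z2 G q w B > 0" "Z G q w B > 0" using Z2_pos[OF fin] Z2_le_Z[OF fin] by auto
  have "ln (Z G q w B) \<le> ln (Z2 G q w B * q powr ?x)"
    using Z_le_Z2[OF fin R] pos q by simp
  also have "\<dots> = ln (Z2 G q w B) + ?x * ln q"
    using pos q by (simp add: ln_mult)
  finally have "ln (Z G q w B) \<le> ln (Z2 G q w B) + ?x * ln q" .
  moreover have "ln (Z2 G q w B) \<le> ln (Z G q w B)" using pos Z2_le_Z[OF fin] by simp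
  ultimately show ?thesis by linarith
qed

end

section \<open>Isomorphism types of neighbourhoods\<close>

lemma rooted_iso_sym:
  assumes "simple_graph (fst A)" "rooted_iso A H" "snd A \<in> verts (fst A)"
  shows "rooted_iso H A"
proof -
  obtain f where f: "bij_betw f (verts (fst A)) (verts (fst H))" "f (snd A) = snd H"
    "(\<lambda>e. f ` e) ` edges (fst A) = edges (fst H)"
    using assms(2) by (auto simp: rooted_iso_def)
  let ?g = "inv_into (verts (fst A)) f"
  have inj: "inj_on f (verts (fst A))" using f(1) by (simp add: bij_betw_def)
  have gf: "?g ` f ` e = e" if "e \<in> edges (fst A)" for e
    using assms(1) that inv_into_image_cancel[OF inj] by (simp add: simple_graph_def)
  have "(\<lambda>e. ?g ` e) ` edges (fst H) = (\<lambda>e. ?g ` f ` e) ` edges (fst A)"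
    unfolding f(3)[symmetric] by (simp add: image_image)
  also have "\<dots> = (\<lambda>e. e) ` edges (fst A)" by (rule image_cong[OF refl gf])
  finally have "(\<lambda>e. ?g ` e) ` edges (fst H) = edges (fst A)" by simp
  moreover have "?g (snd H) = snd A" using inv_into_f_f[OF inj assms(3)] f(2) by simp
  ultimately show ?thesis
    using bij_betw_inv_into[OF f(1)] unfolding rooted_iso_def by blast
qed

lemma rooted_iso_trans:
  assumes "rooted_iso A H" "rooted_iso H K"
  shows "rooted_iso A K"
proof -
  obtain f where f: "bij_betw f (verts (fst A)) (verts (fst H))" "f (snd A) = snd H"
    "(\<lambda>e. f ` e) ` edges (fst A) = edges (fst H)"
    using assms(1) by (auto simp: rooted_iso_def)
  obtain g where g: "bij_betw g (verts (fst H)) (verts (fst K))" "g (snd H) = snd K"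
    "(\<lambda>e. g ` e) ` edges (fst H) = edges (fst K)"
    using assms(2) by (auto simp: rooted_iso_def)
  have "(\<lambda>e. (g \<circ> f) ` e) ` edges (fst A) = (\<lambda>e. g ` e) ` (\<lambda>e. f ` e) ` edges (fst A)"
    by (simp add: image_image image_comp)
  then have "(\<lambda>e. (g \<circ> f) ` e) ` edges (fst A) = edges (fst K)"
    using f(3) g(3) by simp
  moreover have "bij_betw (g \<circ> f) (verts (fst A)) (verts (fst K))"
    using bij_betw_trans f(1) g(1) .
  ultimately show ?thesis
    unfolding rooted_iso_def using f(2) g(2) by (intro exI[of _ "g \<circ> f"]) simp
qed

lemma rooted_iso_cycle:
  assumes "simple_graph (fst A)" "rooted_iso A H" "cycle (fst A) c"
  shows "\<exists>c'. cycle (fst H) c'"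
proof -
  obtain f where f: "bij_betw f (verts (fst A)) (verts (fst H))"
    "(\<lambda>e. f ` e) ` edges (fst A) = edges (fst H)"
    using assms(2) by (auto simp: rooted_iso_def)
  have c: "3 \<le> length c" "distinct c"
    "\<And>i. i < length c \<Longrightarrow> {c ! i, c ! (Suc i mod length c)} \<in> edges (fst A)"
    using assms(3) by (auto simp: cycle_def)
  have "set c \<subseteq> verts (fst A)"
  proof
    fix v assume "v \<in> set c"
    then obtain i where i: "i < length c" "v = c ! i" by (auto simp: in_set_conv_nth)
    then show "v \<in> verts (fst A)" using c(3)[OF i(1)] assms(1) by (auto simp: simple_graph_def)
  qed
  then have "inj_on f (set c)" using f(1) inj_on_subset by (auto simp: bij_betw_def)
  then have "distinct (map f c)" using c(2) by (simp add: distinct_map)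
  moreover have "{map f c ! i, map f c ! (Suc i mod length c)} \<in> edges (fst H)" if "i < length c" for i
  proof -
    have "Suc i mod length c < length c" using that by (intro mod_less_divisor) auto
    then have "{map f c ! i, map f c ! (Suc i mod length c)} = f ` {c ! i, c ! (Suc i mod length c)}"
      using that by simp
    also have "\<dots> \<in> edges (fst H)" unfolding f(2)[symmetric] by (rule imageI) (rule c(3)[OF that])
    finally show ?thesis .
  qed
  ultimately have "cycle (fst H) (map f c)" using c(1) by (simp add: cycle_def)
  then show ?thesis ..
qed

lemma simple_graph_nbhd: "simple_graph G \<Longrightarrow> simple_graph (fst (nbhd G r v))"
  using simple_graph_induced[of G "{u \<in> verts G. \<exists>k\<le>r. (v, u) \<in> adj G ^^ k}"]
  by (simp add: nbhd_def Let_def induced_def)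

lemma root_in_nbhd: "v \<in> verts G \<Longrightarrow> snd (nbhd G r v) \<in> verts (fst (nbhd G r v))"
  by (auto simp: nbhd_def Let_def intro!: exI[of _ 0])

lemma forest_nbhd: "forest G \<Longrightarrow> forest (fst (nbhd G r v))"
  using cycle_mono[of "fst (nbhd G r v)" _ G]
  by (auto simp: forest_def nbhd_def Let_def edges_within_def)

lemma finite_nbhd:
  assumes "simple_graph G" "locally_finite G"
  shows "finite (verts (fst (nbhd G r v)))"
proof -
  have nb: "finite (adj G `` {u})" for u
  proof (cases "u \<in> verts G")
    case True
    have "adj G `` {u} \<subseteq> \<Union>{e \<in> edges G. u \<in> e}" by (auto simp: adj_def)
    moreover have "finite (\<Union>{e \<in> edges G. u \<in> e})"
    proof (rule finite_Union)
      show "finite {e \<in> edges G. u \<in> e}" using assms(2) True by (simp add: locally_finite_def)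
      show "finite e" if "e \<in> {e \<in> edges G. u \<in> e}" for e
        using assms(1) that by (intro card_ge_0_finite) (simp add: simple_graph_def)
    qed
    ultimately show ?thesis by (rule finite_subset)
  next
    case False
    then have "adj G `` {u} = {}" using simple_graph_adjD(1)[OF assms(1)] by auto
    then show ?thesis by simp
  qed
  have "finite ((adj G ^^ k) `` {v})" for k
  proof (induction k)
    case (Suc k)
    have "(adj G ^^ Suc k) `` {v} = (\<Union>u\<in>(adj G ^^ k) `` {v}. adj G `` {u})" by auto
    then show ?case using Suc nb by simp
  qed simp
  then have "finite (\<Union>k\<le>r. (adj G ^^ k) `` {v})" by simp
  then show ?thesis by (rule finite_subset[rotated]) (auto simp: nbhd_def Let_def)
qed

lemma finite_rooted_graph_nbhd:
  assumes "simple_graph G" "locally_finite G" "v \<in> verts G"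
  shows "finite_rooted_graph (nbhd G r v)"
  using simple_graph_nbhd[OF assms(1)] finite_nbhd[OF assms(1,2)] root_in_nbhd[OF assms(3)]
  by (simp add: finite_rooted_graph_def finite_graph_def)

lemma finite_rooted_graph_iso_nat:
  assumes "finite_rooted_graph A"
  shows "\<exists>H::nat rooted_graph. finite_rooted_graph H \<and> rooted_iso A H"
proof -
  obtain G v where A: "A = (G, v)" by fastforce
  have fin: "finite (verts G)" and sg: "simple_graph G" and v: "v \<in> verts G"
    using assms A by (auto simp: finite_rooted_graph_def finite_graph_def)
  obtain h where h: "bij_betw h (verts G) {0..<card (verts G)}"
    using ex_bij_betw_finite_nat[OF fin] by auto
  have inj: "inj_on h (verts G)" using h by (simp add: bij_betw_def)
  define H where "H = (Graph (h ` verts G) ((\<lambda>e. h ` e) ` edges G), h v)"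
  have "card (h ` e) = 2" if "e \<in> edges G" for e
    using sg that card_image[OF inj_on_subset[OF inj]] by (simp add: simple_graph_def)
  then have "simple_graph (fst H)" using sg by (auto simp: H_def simple_graph_def)
  then have "finite_rooted_graph H"
    using fin v by (simp add: H_def finite_rooted_graph_def finite_graph_def)
  moreover have "rooted_iso A H"
    unfolding rooted_iso_def A H_def using inj by (intro exI[of _ h]) (simp add: bij_betw_def)
  ultimately show ?thesis by blast
qed

lemma countable_finite_rooted_graphs: "countable {H :: nat rooted_graph. finite_rooted_graph H}"
proof -
  let ?F = "{U :: nat set. finite U}"
  have F: "countable ?F" by (rule countable_Collect_finite)
  have "countable {E :: nat set set. finite E \<and> E \<subseteq> ?F}"
    by (rule countable_Collect_finite_subset[OF F])
  then have "countable ((\<lambda>(U, E, v). (Graph U E, v)) `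
      (?F \<times> {E. finite E \<and> E \<subseteq> ?F} \<times> (UNIV :: nat set)))"
    using F by (intro countable_image countable_SIGMA) auto
  moreover have "H \<in> (\<lambda>(U, E, v). (Graph U E, v)) `
      (?F \<times> {E. finite E \<and> E \<subseteq> ?F} \<times> (UNIV :: nat set))" if H: "finite_rooted_graph H" for H :: "nat rooted_graph"
  proof -
    have fin: "finite_graph (fst H)" using H by (simp add: finite_rooted_graph_def)
    then have "e \<subseteq> verts (fst H)" if "e \<in> edges (fst H)" for e
      using that by (simp add: finite_graph_def simple_graph_def)
    then have "finite e" if "e \<in> edges (fst H)" for e
      using fin that finite_subset[of e "verts (fst H)"] by (simp add: finite_graph_def)
    then show ?thesis
      using finite_edges[OF fin] fin
      by (intro image_eqI[of _ _ "(verts (fst H), edges (fst H), snd H)"])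
        (auto simp: finite_graph_def)
  qed
  ultimately show ?thesis by (elim countable_subset[rotated]) auto
qed

section \<open>Vertices with a cycle nearby are rare\<close>

text \<open>
  Finitely many pairwise non-isomorphic acyclic graphs carry all but \<open>\<epsilon>\<close> of the law of the
  \<open>r\<close>-neighbourhood of the root. There are countably many finite rooted graphs on natural numbers, the
  acyclic ones almost surely represent the neighbourhood, and continuity of the measure leaves finitely
  many of them.
\<close>

lemma finitely_many_tree_neighbourhoods:
  assumes "prob_space N" "random_rooted_graph N T" "AE y in N. tree (fst (T y))" "\<epsilon> > 0"
  shows "\<exists>\<H> :: nat rooted_graph set. finite \<H> \<and>
    (\<forall>H\<in>\<H>. finite_rooted_graph H \<and> forest (fst H)) \<and>
    (\<forall>H\<in>\<H>. \<forall>K\<in>\<H>. rooted_iso H K \<longrightarrow> H = K) \<and>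
    (\<Sum>H\<in>\<H>. measure N {y \<in> space N. rooted_iso (nbhd (fst (T y)) r (snd (T y))) H}) > 1 - \<epsilon>"
proof -
  interpret N: prob_space N by fact
  let ?nb = "\<lambda>y. nbhd (fst (T y)) r (snd (T y))"
  have T: "simple_graph (fst (T y))" "locally_finite (fst (T y))" "snd (T y) \<in> verts (fst (T y))"
    if "y \<in> space N" for y using assms(2) that by (auto simp: random_rooted_graph_def)
  let ?F = "{H :: nat rooted_graph. finite_rooted_graph H \<and> forest (fst H)}"
  let ?E = "\<lambda>H :: nat rooted_graph. {y \<in> space N. rooted_iso (?nb y) H}"
  have meas: "?E H \<in> sets N" if "finite_rooted_graph H" for H
    using assms(2) that unfolding random_rooted_graph_def by blast
  have nb_fin: "finite_rooted_graph (?nb y)" if "y \<in> space N" for y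
    using finite_rooted_graph_nbhd[OF T[OF that]] .
  have nb_simple: "simple_graph (fst (?nb y))" "snd (?nb y) \<in> verts (fst (?nb y))" if "y \<in> space N" for y
    using nb_fin[OF that] by (auto simp: finite_rooted_graph_def finite_graph_def)
  have countable: "countable ?F"
    by (rule countable_subset[OF _ countable_finite_rooted_graphs]) auto
  have "(Graph {0} {}, 0) \<in> ?F"
    by (auto simp: finite_rooted_graph_def finite_graph_def simple_graph_def forest_def cycle_def
        intro!: exI[of _ 0])
  then have "?F \<noteq> {}" by blast
  define h where "h = from_nat_into ?F"
  have h: "range h = ?F"
    unfolding h_def using \<open>?F \<noteq> {}\<close> countable by (rule range_from_nat_into)
  have hF: "finite_rooted_graph (h i)" "forest (fst (h i))" for i using h by auto
  have measE: "?E (h i) \<in> sets N" for i using hF(1) by (rule meas)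
  have cover: "AE y in N. y \<in> (\<Union>i. ?E (h i))"
    using assms(3)
  proof (rule AE_mp, intro AE_I2 impI)
    fix y assume y: "y \<in> space N" and "tree (fst (T y))"
    then have "forest (fst (T y))" by (simp add: tree_def forest_def)
    then have fo: "forest (fst (?nb y))" by (rule forest_nbhd)
    obtain H :: "nat rooted_graph" where H: "finite_rooted_graph H" "rooted_iso (?nb y) H"
      using finite_rooted_graph_iso_nat[OF nb_fin[OF y]] by blast
    have "simple_graph (fst H)" using H by (simp add: finite_rooted_graph_def finite_graph_def)
    then have "forest (fst H)"
      using rooted_iso_cycle[OF _ rooted_iso_sym[OF nb_simple(1)[OF y] H(2) nb_simple(2)[OF y]]] fo
      by (auto simp: forest_def)
    then have "H \<in> range h" using h H by auto
    then show "y \<in> (\<Union>i. ?E (h i))" using H y by auto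
  qed
  have Em: "(\<Union>i<m. ?E (h i)) \<in> sets N" for m
    using measE by (intro sets.finite_UN) auto
  have "(\<lambda>m. measure N (\<Union>i<m. ?E (h i))) \<longlonglongrightarrow> measure N (\<Union>m. \<Union>i<m. ?E (h i))"
  proof (rule N.finite_Lim_measure_incseq)
    show "range (\<lambda>m. \<Union>i<m. ?E (h i)) \<subseteq> sets N" using Em by auto
    show "incseq (\<lambda>m. \<Union>i<m. ?E (h i))" by (intro monoI UN_mono) auto
  qed
  moreover have "(\<Union>m. \<Union>i<m. ?E (h i)) = (\<Union>i. ?E (h i))" by auto
  moreover have "measure N (\<Union>i. ?E (h i)) = 1"
    using cover measE by (subst N.prob_eq_1) (auto intro!: sets.countable_UN)
  ultimately have "(\<lambda>m. measure N (\<Union>i<m. ?E (h i))) \<longlonglongrightarrow> 1" by simp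
  then have "\<forall>\<^sub>F m in sequentially. measure N (\<Union>i<m. ?E (h i)) > 1 - \<epsilon>"
    by (rule order_tendstoD) (use assms(4) in simp)
  then obtain m where m: "measure N (\<Union>i<m. ?E (h i)) > 1 - \<epsilon>"
    by (auto dest: eventually_happens)
  \<comment> \<open>Of each isomorphism type among \<open>h 0, \<dots>, h (m - 1)\<close>, keep the representative of least index.\<close>
  define J where "J = {i. i < m \<and> (\<forall>j<i. \<not> rooted_iso (h j) (h i))}"
  have iso_h_sym: "rooted_iso (h i) (h j) \<Longrightarrow> rooted_iso (h j) (h i)" for i j
    using rooted_iso_sym[of "h i" "h j"] hF(1)[of i] by (simp add: finite_rooted_graph_def finite_graph_def)
  have J_inj: "i = j" if "i \<in> J" "j \<in> J" "rooted_iso (h i) (h j)" for i j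
    using that iso_h_sym[of i j] by (cases i j rule: linorder_cases) (auto simp: J_def)
  have "finite J" by (simp add: J_def)
  have inj_h: "inj_on h J"
  proof (rule inj_onI)
    fix i j assume ij: "i \<in> J" "j \<in> J" "h i = h j"
    have "rooted_iso (h i) (h i)" unfolding rooted_iso_def by (intro exI[of _ id]) simp
    then show "i = j" using ij J_inj by metis
  qed
  have sub: "(\<Union>i<m. ?E (h i)) \<subseteq> (\<Union>i\<in>J. ?E (h i))"
  proof
    fix y assume "y \<in> (\<Union>i<m. ?E (h i))"
    then obtain i0 where i0: "i0 < m" "y \<in> space N" "rooted_iso (?nb y) (h i0)" by auto
    define i where "i = (LEAST i. rooted_iso (?nb y) (h i))"
    have i: "rooted_iso (?nb y) (h i)" unfolding i_def using i0(3) by (rule LeastI)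
    have "i \<le> i0" unfolding i_def using i0(3) by (rule Least_le)
    have "\<not> rooted_iso (h j) (h i)" if j: "j < i" for j
    proof
      assume "rooted_iso (h j) (h i)"
      then have "rooted_iso (?nb y) (h j)" using rooted_iso_trans[OF i iso_h_sym] by blast
      then show False using not_less_Least[of j] j unfolding i_def by blast
    qed
    then have "i \<in> J" using \<open>i \<le> i0\<close> i0(1) by (simp add: J_def)
    then show "y \<in> (\<Union>i\<in>J. ?E (h i))" using i i0(2) by auto
  qed
  have "1 - \<epsilon> < measure N (\<Union>i<m. ?E (h i))" by (rule m)
  also have "\<dots> \<le> measure N (\<Union>i\<in>J. ?E (h i))"
    using sub measE \<open>finite J\<close> by (intro N.finite_measure_mono sets.finite_UN) auto
  also have "\<dots> \<le> (\<Sum>i\<in>J. measure N (?E (h i)))"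
    using \<open>finite J\<close> measE by (intro N.finite_measure_subadditive_finite) auto
  also have "\<dots> = (\<Sum>H\<in>h ` J. measure N (?E H))"
    using inj_h by (simp add: sum.reindex)
  finally have "(\<Sum>H\<in>h ` J. measure N (?E H)) > 1 - \<epsilon>" .
  moreover have "\<forall>H\<in>h ` J. \<forall>K\<in>h ` J. rooted_iso H K \<longrightarrow> H = K" using J_inj by auto
  ultimately show ?thesis using \<open>finite J\<close> hF by (intro exI[of _ "h ` J"]) simp
qed

text \<open>
  A vertex whose neighbourhood has an acyclic type is not counted by \<open>cyclic_verts\<close>, and it is counted
  for at most one of the pairwise non-isomorphic types in \<open>\<H>\<close>.
\<close>

lemma card_cyclic_verts_le:
  fixes G :: "'v graph" and \<H> :: "nat rooted_graph set"
  assumes fin: "finite_graph G" and "finite \<H>" and acyclic: "\<forall>H\<in>\<H>. finite_rooted_graph H \<and> forest (fst H)"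
    and distinct: "\<forall>H\<in>\<H>. \<forall>K\<in>\<H>. rooted_iso H K \<longrightarrow> H = K"
  shows "card (cyclic_verts G r) + (\<Sum>H\<in>\<H>. card {v \<in> verts G. rooted_iso (nbhd G r v) H})
    \<le> card (verts G)"
proof -
  have sg: "simple_graph G" and finV: "finite (verts G)" using fin by (auto simp: finite_graph_def)
  let ?W = "\<lambda>H. {v \<in> verts G. rooted_iso (nbhd G r v) H}"
  have "card (\<Union>H\<in>\<H>. ?W H) = (\<Sum>H\<in>\<H>. card (?W H))"
  proof (rule card_UN_disjoint[OF \<open>finite \<H>\<close>])
    show "\<forall>H\<in>\<H>. finite (?W H)" using finV by simp
    show "\<forall>H\<in>\<H>. \<forall>K\<in>\<H>. H \<noteq> K \<longrightarrow> ?W H \<inter> ?W K = {}"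
    proof (intro ballI impI)
      fix H K assume HK: "H \<in> \<H>" "K \<in> \<H>" "H \<noteq> K"
      have False if v: "v \<in> verts G" "rooted_iso (nbhd G r v) H" "rooted_iso (nbhd G r v) K" for v
        using rooted_iso_trans[OF rooted_iso_sym[OF simple_graph_nbhd[OF sg] v(2) root_in_nbhd[OF v(1)]] v(3)]
          distinct HK by blast
      then show "?W H \<inter> ?W K = {}" by auto
    qed
  qed
  moreover have "cyclic_verts G r \<inter> (\<Union>H\<in>\<H>. ?W H) = {}"
  proof -
    have False if v: "v \<in> cyclic_verts G r" "H \<in> \<H>" "rooted_iso (nbhd G r v) H" for v H
    proof -
      obtain c where "cycle (fst (nbhd G r v)) c" using v(1) by (auto simp: cyclic_verts_def forest_def)
      then show False
        using rooted_iso_cycle[OF simple_graph_nbhd[OF sg] v(3)] acyclic v(2)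
        by (auto simp: forest_def)
    qed
    then show ?thesis by auto
  qed
  then have "card (cyclic_verts G r) + card (\<Union>H\<in>\<H>. ?W H) = card (cyclic_verts G r \<union> (\<Union>H\<in>\<H>. ?W H))"
    using finV \<open>finite \<H>\<close> by (intro card_Un_disjoint[symmetric]) (auto simp: cyclic_verts_def)
  moreover have "card (cyclic_verts G r \<union> (\<Union>H\<in>\<H>. ?W H)) \<le> card (verts G)"
    using finV by (intro card_mono) (auto simp: cyclic_verts_def)
  ultimately show ?thesis by simp
qed

lemma random_finite_graph_sets:
  assumes "random_finite_graph M n G"
  shows "{x \<in> space M. P (G x)} \<in> sets M"
proof -
  have "G \<in> M \<rightarrow>\<^sub>M count_space UNIV" using assms by (simp add: random_finite_graph_def)
  then have "G -` {g. P g} \<inter> space M \<in> sets M" by (rule measurable_sets) simp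
  moreover have "G -` {g. P g} \<inter> space M = {x \<in> space M. P (G x)}" by auto
  ultimately show ?thesis by simp
qed

lemma cyclic_verts_rare:
  fixes G :: "nat \<Rightarrow> 'w \<Rightarrow> 'v graph"
  assumes M: "prob_space M"
    and G: "\<And>n. n \<ge> 1 \<Longrightarrow> random_finite_graph M n (G n)"
    and tl: "locally_tree_like M G N T" and "\<delta> > 0"
  shows "(\<lambda>n. measure M {x \<in> space M. real (card (cyclic_verts (G n x) r)) / real n > \<delta>}) \<longlonglongrightarrow> 0"
proof -
  interpret M: prob_space M by fact
  have N: "prob_space N" "random_rooted_graph N T" "AE y in N. tree (fst (T y))"
    and conv: "converges_locally_in_prob M G N T"
    using tl by (auto simp: locally_tree_like_def)
  let ?\<mu> = "\<lambda>H :: nat rooted_graph. measure N {y \<in> space N. rooted_iso (nbhd (fst (T y)) r (snd (T y))) H}"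
  let ?W = "\<lambda>g H. {v \<in> verts g. rooted_iso (nbhd g r v) H}"
  obtain \<H> :: "nat rooted_graph set" where fin: "finite \<H>"
    and H: "\<forall>H\<in>\<H>. finite_rooted_graph H \<and> forest (fst H)"
    and distinct: "\<forall>H\<in>\<H>. \<forall>K\<in>\<H>. rooted_iso H K \<longrightarrow> H = K"
    and mass: "(\<Sum>H\<in>\<H>. ?\<mu> H) > 1 - \<delta> / 2"
    using finitely_many_tree_neighbourhoods[OF N, of "\<delta> / 2" r] \<open>\<delta> > 0\<close> by auto
  \<comment> \<open>If each of the \<open>card \<H>\<close> proportions is within \<open>\<eta>\<close> of its limit, the sum loses at most \<open>\<delta> / 2\<close>;
    the added \<open>1\<close> covers the case of an empty \<open>\<H>\<close>.\<close>
  define \<eta> where "\<eta> = \<delta> / (2 * (real (card \<H>) + 1))"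
  have \<eta>: "\<eta> > 0" using \<open>\<delta> > 0\<close> by (simp add: \<eta>_def)
  have "\<eta> * real (card \<H>) \<le> \<eta> * (real (card \<H>) + 1)" using \<eta> by (intro mult_left_mono) auto
  also have "\<dots> = \<delta> / 2" by (simp add: \<eta>_def field_simps)
  finally have \<eta>_card: "\<eta> * real (card \<H>) \<le> \<delta> / 2" .
  let ?B = "\<lambda>n H. {x \<in> space M. \<bar>real (card (?W (G n x) H)) / real (card (verts (G n x))) - ?\<mu> H\<bar> > \<eta>}"
  have "(\<lambda>n. measure M (?B n H)) \<longlonglongrightarrow> 0" if "H \<in> \<H>" for H
    using conv H that \<eta> unfolding converges_locally_in_prob_def tendsto_in_prob_def by blast
  then have lim: "(\<lambda>n. \<Sum>H\<in>\<H>. measure M (?B n H)) \<longlonglongrightarrow> 0"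
    by (intro tendsto_null_sum)
  have bound: "measure M {x \<in> space M. real (card (cyclic_verts (G n x) r)) / real n > \<delta>} \<le>
      (\<Sum>H\<in>\<H>. measure M (?B n H))" if n: "n \<ge> 1" for n
  proof -
    have meas: "?B n H \<in> sets M" for H
      using random_finite_graph_sets[OF G[OF n], of
          "\<lambda>g. \<bar>real (card (?W g H)) / real (card (verts g)) - ?\<mu> H\<bar> > \<eta>"] .
    have "{x \<in> space M. real (card (cyclic_verts (G n x) r)) / real n > \<delta>} \<subseteq> (\<Union>H\<in>\<H>. ?B n H)"
    proof (rule ccontr)
      assume "\<not> ?thesis"
      then obtain x where x: "x \<in> space M" "real (card (cyclic_verts (G n x) r)) / real n > \<delta>"
        and nB: "\<And>H. H \<in> \<H> \<Longrightarrow> x \<notin> ?B n H" by blast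
      let ?g = "G n x"
      have g: "finite_graph ?g" "card (verts ?g) = n"
        using G[OF n] x(1) by (auto simp: random_finite_graph_def)
      have "1 - \<delta> / 2 - \<delta> / 2 < (\<Sum>H\<in>\<H>. ?\<mu> H) - \<eta> * real (card \<H>)" using mass \<eta>_card by linarith
      also have "\<dots> = (\<Sum>H\<in>\<H>. ?\<mu> H - \<eta>)" by (simp add: sum_subtractf)
      also have "\<dots> \<le> (\<Sum>H\<in>\<H>. real (card (?W ?g H)) / real n)"
      proof (rule sum_mono)
        fix H assume "H \<in> \<H>"
        then have "\<bar>real (card (?W ?g H)) / real n - ?\<mu> H\<bar> \<le> \<eta>" using nB[of H] x(1) g(2) by simp
        then show "?\<mu> H - \<eta> \<le> real (card (?W ?g H)) / real n" by linarith
      qed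
      finally have *: "1 - \<delta> < (\<Sum>H\<in>\<H>. real (card (?W ?g H)) / real n)" by simp
      have "real (card (cyclic_verts ?g r) + (\<Sum>H\<in>\<H>. card (?W ?g H))) \<le> real n"
        using card_cyclic_verts_le[OF g(1) fin H distinct, of r] g(2) by (simp only: of_nat_le_iff)
      then have "(real (card (cyclic_verts ?g r)) + (\<Sum>H\<in>\<H>. real (card (?W ?g H)))) / real n \<le> 1"
        using n by simp
      then show False using * x(2) by (simp add: add_divide_distrib sum_divide_distrib)
    qed
    then have "measure M {x \<in> space M. real (card (cyclic_verts (G n x) r)) / real n > \<delta>} \<le>
        measure M (\<Union>H\<in>\<H>. ?B n H)"
      using meas fin by (intro M.finite_measure_mono sets.finite_UN) auto
    also have "\<dots> \<le> (\<Sum>H\<in>\<H>. measure M (?B n H))"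
      using fin meas by (intro M.finite_measure_subadditive_finite) auto
    finally show ?thesis .
  qed
  show ?thesis
  proof (rule tendsto_sandwich[OF _ _ tendsto_const lim])
    show "\<forall>\<^sub>F n in sequentially. 0 \<le> measure M {x \<in> space M. real (card (cyclic_verts (G n x) r)) / real n > \<delta>}"
      by simp
    show "\<forall>\<^sub>F n in sequentially. measure M {x \<in> space M. real (card (cyclic_verts (G n x) r)) / real n > \<delta>}
        \<le> (\<Sum>H\<in>\<H>. measure M (?B n H))"
      using eventually_ge_at_top[of 1] by (rule eventually_mono) (rule bound)
  qed
qed

section \<open>Convergence in probability\<close>

lemma tendsto_in_prob_cong:
  assumes M: "prob_space M"
    and X: "\<And>n. n \<ge> 1 \<Longrightarrow> X n \<in> borel_measurable M"
    and Y: "\<And>n. n \<ge> 1 \<Longrightarrow> Y n \<in> borel_measurable M"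
    and diff: "\<And>\<epsilon>. \<epsilon> > 0 \<Longrightarrow> (\<lambda>n. measure M {x \<in> space M. \<bar>X n x - Y n x\<bar> > \<epsilon>}) \<longlonglongrightarrow> 0"
    and lim: "tendsto_in_prob M X L"
  shows "tendsto_in_prob M Y L"
  unfolding tendsto_in_prob_def
proof (intro conjI allI impI)
  interpret M: prob_space M by fact
  show L: "L \<in> borel_measurable M" using lim by (simp add: tendsto_in_prob_def)
  fix \<epsilon> :: real assume \<epsilon>: "\<epsilon> > 0"
  let ?S = "\<lambda>n. {x \<in> space M. \<bar>Y n x - L x\<bar> > \<epsilon>}"
  let ?S1 = "\<lambda>n. {x \<in> space M. \<bar>X n x - Y n x\<bar> > \<epsilon> / 2}"
  let ?S2 = "\<lambda>n. {x \<in> space M. \<bar>X n x - L x\<bar> > \<epsilon> / 2}"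
  have bound: "measure M (?S n) \<le> measure M (?S1 n) + measure M (?S2 n)" if n: "n \<ge> 1" for n
  proof -
    have [measurable]: "X n \<in> borel_measurable M" "Y n \<in> borel_measurable M" "L \<in> borel_measurable M"
      using X Y L n by auto
    have m: "?S1 n \<in> sets M" "?S2 n \<in> sets M" by measurable
    have "?S n \<subseteq> ?S1 n \<union> ?S2 n" by (auto simp: abs_if split: if_splits)
    then have "measure M (?S n) \<le> measure M (?S1 n \<union> ?S2 n)"
      using m by (intro M.finite_measure_mono) auto
    also have "\<dots> \<le> measure M (?S1 n) + measure M (?S2 n)"
      using m by (rule measure_Un_le)
    finally show ?thesis .
  qed
  have "(\<lambda>n. measure M (?S1 n) + measure M (?S2 n)) \<longlonglongrightarrow> 0 + 0"
  proof (rule tendsto_add)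
    show "(\<lambda>n. measure M (?S1 n)) \<longlonglongrightarrow> 0" using \<epsilon> by (intro diff) simp
    have "\<epsilon> / 2 > 0" using \<epsilon> by simp
    then show "(\<lambda>n. measure M (?S2 n)) \<longlonglongrightarrow> 0" using lim unfolding tendsto_in_prob_def by blast
  qed
  then have sum: "(\<lambda>n. measure M (?S1 n) + measure M (?S2 n)) \<longlonglongrightarrow> 0" by simp
  show "(\<lambda>n. measure M (?S n)) \<longlonglongrightarrow> 0"
  proof (rule tendsto_sandwich[OF _ _ tendsto_const sum])
    show "\<forall>\<^sub>F n in sequentially. 0 \<le> measure M (?S n)" by simp
    show "\<forall>\<^sub>F n in sequentially. measure M (?S n) \<le> measure M (?S1 n) + measure M (?S2 n)"
      using eventually_ge_at_top[of 1] by (rule eventually_mono) (rule bound)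
  qed
qed

lemma free_energy_diff:
  fixes M :: "'w measure" and G :: "nat \<Rightarrow> 'w \<Rightarrow> 'v graph"
  assumes M: "prob_space M"
    and G: "\<And>n. n \<ge> 1 \<Longrightarrow> random_finite_graph M n (G n)"
    and tl: "locally_tree_like M G N T"
    and q: "q \<ge> 2" and w: "w \<ge> 0" and B: "B \<ge> 0" and \<epsilon>: "\<epsilon> > 0"
  shows "(\<lambda>n. measure M {x \<in> space M.
    \<bar>1 / real n * ln (Z (G n x) q w B) - 1 / real n * ln (Z2 (G n x) q w B)\<bar> > \<epsilon>}) \<longlonglongrightarrow> 0"
proof -
  interpret M: prob_space M by fact
  have lnq: "ln q > 0" using q by simp
  \<comment> \<open>With this \<open>R\<close> and \<open>\<delta>\<close>, the large components and the vertices with a cycle nearby contribute at most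
    \<open>\<epsilon> / 2\<close> each.\<close>
  obtain R :: nat where R: "real R > 2 * ln q / \<epsilon>" using reals_Archimedean2 by blast
  have "2 * ln q / \<epsilon> > 0" using lnq \<epsilon> by simp
  then have R1: "R \<ge> 1" using R by linarith
  have Rq: "ln q / real R \<le> \<epsilon> / 2" using R R1 \<epsilon> by (simp add: field_simps)
  define \<delta> where "\<delta> = \<epsilon> / (2 * ln q)"
  have \<delta>: "\<delta> > 0" using \<epsilon> lnq by (simp add: \<delta>_def)
  let ?S = "\<lambda>n. {x \<in> space M.
    \<bar>1 / real n * ln (Z (G n x) q w B) - 1 / real n * ln (Z2 (G n x) q w B)\<bar> > \<epsilon>}"
  let ?C = "\<lambda>n. {x \<in> space M. real (card (cyclic_verts (G n x) (R\<^sup>2))) / real n > \<delta>}"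
  have bound: "measure M (?S n) \<le> measure M (?C n)" if n: "n \<ge> 1" for n
  proof (rule M.finite_measure_mono)
    show "?C n \<in> sets M"
      using random_finite_graph_sets[OF G[OF n], of "\<lambda>g. real (card (cyclic_verts g (R\<^sup>2))) / real n > \<delta>"] .
    show "?S n \<subseteq> ?C n"
    proof (rule ccontr)
      assume "\<not> ?thesis"
      then obtain x where x: "x \<in> space M" "x \<in> ?S n" "x \<notin> ?C n" by blast
      let ?g = "G n x"
      let ?c = "real (card (cyclic_verts ?g (R\<^sup>2)))"
      have g: "finite_graph ?g" "card (verts ?g) = n"
        using G[OF n] x(1) by (auto simp: random_finite_graph_def)
      have "?c / real n \<le> \<delta>" using x by auto
      then have "?c / real n * ln q \<le> \<delta> * ln q" using lnq by (intro mult_right_mono) auto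
      also have "\<dots> = \<epsilon> / 2" using lnq by (simp add: \<delta>_def)
      finally have c: "?c / real n * ln q \<le> \<epsilon> / 2" .
      have "1 / real n * ln (Z ?g q w B) - 1 / real n * ln (Z2 ?g q w B) =
          (ln (Z ?g q w B) - ln (Z2 ?g q w B)) / real n" by (simp add: diff_divide_distrib)
      then have "\<bar>1 / real n * ln (Z ?g q w B) - 1 / real n * ln (Z2 ?g q w B)\<bar> =
          \<bar>ln (Z ?g q w B) - ln (Z2 ?g q w B)\<bar> / real n" by simp
      also have "\<dots> \<le> (real n / real R + ?c) * ln q / real n"
        using ln_Z_diff[OF q w B g(1) R1] g(2) by (intro divide_right_mono) auto
      also have "\<dots> = ln q / real R + ?c / real n * ln q"
        using n R1 by (simp add: field_simps)
      also have "\<dots> \<le> \<epsilon>" using Rq c by linarith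
      finally show False using x(2) by auto
    qed
  qed
  show ?thesis
  proof (rule tendsto_sandwich[OF _ _ tendsto_const cyclic_verts_rare[OF M G tl \<delta>, of "R\<^sup>2"]])
    show "\<forall>\<^sub>F n in sequentially. 0 \<le> measure M (?S n)" by simp
    show "\<forall>\<^sub>F n in sequentially. measure M (?S n) \<le> measure M (?C n)"
      using eventually_ge_at_top[of 1] by (rule eventually_mono) (rule bound)
  qed
qed

theorem corollary1p5:
  fixes M :: "'w measure" and G :: "nat \<Rightarrow> 'w \<Rightarrow> 'v graph"
    and N :: "'l measure" and T :: "'l \<Rightarrow> 'u rooted_graph"
    and q w B :: real
  assumes "prob_space M"
    and "\<And>n. n \<ge> 1 \<Longrightarrow> random_finite_graph M n (G n)"
    and "locally_tree_like M G N T"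
    and "q \<ge> 2" and "w \<ge> 0" and "B \<ge> 0"
  shows "\<forall>X. tendsto_in_prob M (\<lambda>n x. 1 / real n * ln (Z (G n x) q w B)) X \<longleftrightarrow>
             tendsto_in_prob M (\<lambda>n x. 1 / real n * ln (Z2 (G n x) q w B)) X"
proof -
  let ?X = "\<lambda>n x. 1 / real n * ln (Z (G n x) q w B)"
  let ?Y = "\<lambda>n x. 1 / real n * ln (Z2 (G n x) q w B)"
  have "(\<lambda>x. 1 / real n * ln (f (G n x))) \<in> borel_measurable M" if "n \<ge> 1" for n and f :: "'v graph \<Rightarrow> real"
    using assms(2)[OF that] measurable_compose[of "G n" M "count_space UNIV" "\<lambda>g. 1 / real n * ln (f g)" borel]
    by (simp add: random_finite_graph_def)
  then have meas: "?X n \<in> borel_measurable M" "?Y n \<in> borel_measurable M" if "n \<ge> 1" for n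
    using that by auto
  have diff: "(\<lambda>n. measure M {x \<in> space M. \<bar>?X n x - ?Y n x\<bar> > \<epsilon>}) \<longlonglongrightarrow> 0" if "\<epsilon> > 0" for \<epsilon>
    using free_energy_diff[OF assms that] by simp
  then have diff': "(\<lambda>n. measure M {x \<in> space M. \<bar>?Y n x - ?X n x\<bar> > \<epsilon>}) \<longlonglongrightarrow> 0" if "\<epsilon> > 0" for \<epsilon>
    using that by (simp add: abs_minus_commute)
  show ?thesis
    using tendsto_in_prob_cong[OF assms(1), of ?X ?Y, OF meas diff]
      tendsto_in_prob_cong[OF assms(1), of ?Y ?X, OF meas(2,1) diff'] by blast
qed

end
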